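(* Let $G=(\mathcal{A},\varphi,w)$ be an injective D0L system. Then $G$ is not circular if and only if $G$ is unboundedly repetitive.
   Context: Words: $\mathcal{A}$ is a finite alphabet, $\mathcal{A}^*$ is the free monoid of finite words over $\mathcal{A}$, $\varepsilon$ is the empty word, $\mathcal{A}^+=\mathcal{A}^*\setminus\{\varepsilon\}$, and $|u|$ is the length of $u$. A word $u$ is a factor of $x$ if $x=pus$ for some (possibly empty) words $p,s$. $\mathbb{N}$ includes $0$. A D0L system is a triplet $G=(\mathcal{A},\varphi,w)$ where $\varphi$ is an endomorphism of $\mathcal{A}^*$ and $w\in\mathcal{A}^*$ (the axiom). Its language is $L(G)=\{\varphi^n(w): n\in\mathbb{N}\}$, and $S(L(G))$ is the set of all factors of words of $L(G)$. It is assumed that the alphabet is minimal, i.e. every letter of $\mathcal{A}$ belongs to $S(L(G))$. $G$ is injective if for all $x,y\in S(L(G))$, $\varphi(x)=\varphi(y)$ implies $x=y$. (In particular $\varphi$ is then non-erasing, i.e. $\varphi(a)\ne\varepsilon$ for every letter $a$.) A letter $a$ is bounded if the set $\{\varphi^n(a):n\in\mathbb{N}\}$ is finite, and unbounded otherwise. $G$ is unboundedly repetitive if there exists $x\in S(L(G))$ containing at least one unbounded letter such that $x^k\in S(L(G))$ for all $k\in\mathbb{N}$. Interpretations: for $\varphi$ non-erasing, an interpretation of a word $u\in S(L(G))$ is a triplet $(p,v,s)$ with $p,s\in\mathcal{A}^*$, $v\in\mathcal{A}^+$, $v\in S(L(G))$ and $\varphi(v)=pus$. Circularity: $G$ (with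 $\varphi$ non-erasing) is circular if there is a constant $D>0$ (a synchronization delay) such that for every non-empty $u\in S(L(G))$ and any two interpretations $(p,v,s)$, $(p',v',s')$ of $u$, with $v=v_1\cdots v_n$ and $v'=v'_1\cdots v'_m$ (letters), the following holds: whenever $1\le i\le n$ satisfies $$|\varphi(v_1\cdots v_i)|-|p|>D\quad\text{and}\quad |\varphi(v_{i+1}\cdots v_n)|-|s|>D,$$ there is $1\le j\le m$ such that $$|\varphi(v_1\cdots v_{i-1})|-|p|=|\varphi(v'_1\cdots v'_{j-1})|-|p'|\quad\text{and}\quad v_i=v'_j .$$ *)

theory Defs
  imports Main "HOL-Library.Sublist"
begin

text \<open>
  Words are lists and the free monoid over an alphabet is the set \<^term>\<open>lists A\<close>. The alphabet is an
  explicit set of letters, so it may be empty. The morphism acts on words; its values on lists that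
  are not words over the alphabet are irrelevant.
\<close>

record 'a D0L =
  alphabet :: "'a set"
  morph :: "'a list \<Rightarrow> 'a list"
  start :: "'a list"

definition endomorphism_on :: "'a set \<Rightarrow> ('a list \<Rightarrow> 'a list) \<Rightarrow> bool" where
  "endomorphism_on A \<phi> \<longleftrightarrow>
     (\<forall>x \<in> lists A. \<phi> x \<in> lists A) \<and>
     \<phi> [] = [] \<and>
     (\<forall>x \<in> lists A. \<forall>y \<in> lists A. \<phi> (x @ y) = \<phi> x @ \<phi> y)"

definition D0L_language :: "'a D0L \<Rightarrow> 'a list set" where
  "D0L_language G = {(morph G ^^ n) (start G) | n. True}"

definition D0L_factors :: "'a D0L \<Rightarrow> 'a list set" where
  "D0L_factors G = {u. \<exists>x \<in> D0L_language G. sublist u x}"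

text \<open>The last conjunct is the standing assumption that the alphabet is minimal.\<close>

definition D0L_system :: "'a D0L \<Rightarrow> bool" where
  "D0L_system G \<longleftrightarrow>
     finite (alphabet G) \<and>
     endomorphism_on (alphabet G) (morph G) \<and>
     start G \<in> lists (alphabet G) \<and>
     (\<forall>a \<in> alphabet G. [a] \<in> D0L_factors G)"

definition injective_D0L :: "'a D0L \<Rightarrow> bool" where
  "injective_D0L G \<longleftrightarrow>
     (\<forall>x \<in> D0L_factors G. \<forall>y \<in> D0L_factors G. morph G x = morph G y \<longrightarrow> x = y)"

definition bounded_letter :: "'a D0L \<Rightarrow> 'a \<Rightarrow> bool" where
  "bounded_letter G a \<longleftrightarrow> finite {(morph G ^^ n) [a] | n. True}"

definition unboundedly_repetitive :: "'a D0L \<Rightarrow> bool" where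
  "unboundedly_repetitive G \<longleftrightarrow>
     (\<exists>x \<in> D0L_factors G.
        (\<exists>a \<in> set x. \<not> bounded_letter G a) \<and>
        (\<forall>k. concat (replicate k x) \<in> D0L_factors G))"

definition interpretation_of ::
    "'a D0L \<Rightarrow> 'a list \<Rightarrow> 'a list \<Rightarrow> 'a list \<Rightarrow> 'a list \<Rightarrow> bool" where
  "interpretation_of G u p v s \<longleftrightarrow>
     p \<in> lists (alphabet G) \<and> s \<in> lists (alphabet G) \<and>
     v \<noteq> [] \<and> v \<in> D0L_factors G \<and>
     morph G v = p @ u @ s"

text \<open>
  Letters are indexed from 0, so the letter at index \<open>i\<close> is preceded by \<^term>\<open>take i v\<close> and followed by
  \<^term>\<open>drop (Suc i) v\<close>. Lengths are compared as integers because the differences may be negative.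
  This notion is meant for non-erasing morphisms; an injective system is always non-erasing,
  since every letter and the empty word are factors.
\<close>

definition synchronization_delay :: "'a D0L \<Rightarrow> int \<Rightarrow> bool" where
  "synchronization_delay G D \<longleftrightarrow>
     (\<forall>u p v s p' v' s'.
        u \<in> D0L_factors G \<and> u \<noteq> [] \<and>
        interpretation_of G u p v s \<and> interpretation_of G u p' v' s' \<longrightarrow>
        (\<forall>i < length v.
           int (length (morph G (take (Suc i) v))) - int (length p) > D \<and>
           int (length (morph G (drop (Suc i) v))) - int (length s) > D \<longrightarrow>
           (\<exists>j < length v'.
              int (length (morph G (take i v))) - int (length p) =
                int (length (morph G (take j v'))) - int (length p') \<and>
              v ! i = v' ! j)))"

definition circular_D0L :: "'a D0L \<Rightarrow> bool" where
  "circular_D0L G \<longleftrightarrow> (\<exists>D > 0. synchronization_delay G D)"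

end

theory Submission
  imports Defs
begin

text \<open>
  Call the positions in \<open>\<phi>(v)\<close> at which the image of a letter begins or ends the cuts of \<open>v\<close>.

  A circular system is not unboundedly repetitive. If all powers of \<open>x\<close> are factors, then a high power
  of \<open>x\<close> lies in some \<open>\<phi>(v)\<close>, and the power with one \<open>x\<close> less has two interpretations by \<open>v\<close>, shifted
  by \<open>|x|\<close> against each other. Synchronization makes the middle of \<open>v\<close> periodic, with a period \<open>y\<close> such that
  \<open>\<phi>(y)\<close> is a conjugate of \<open>x\<close>; again all powers of \<open>y\<close> are factors (\<open>repetition_descends\<close>). Iterating,
  \<open>x\<close> has ancestors \<open>y\<^sub>1, y\<^sub>2, \<dots>\<close> of length at most \<open>|x|\<close>. Two of them coincide, so the lengths
  of the iterates of \<open>x\<close> are periodic, hence bounded, and \<open>x\<close> has only bounded letters.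

  Conversely, assume that there is no synchronization delay. Between two common cuts of two interpretations,
  injectivity forces equality; so a failure far from both ends produces factors \<open>x\<close>, \<open>y\<close> with \<open>x\<close>
  arbitrarily long such that \<open>\<phi>(y)\<close> covers \<open>\<phi>(x)\<close> and no cut of \<open>x\<close> is a cut of \<open>y\<close>
  (\<open>no_sync_delay_imp_desync\<close>). The core of the proof is a defect theorem: if a morphism \<open>f\<close> on an
  alphabet \<open>A\<close> is elementary, that is, if its images of letters are not all products of fewer than \<open>|A|\<close>
  words, then every long covering of this kind contains a high power of a short word
  (\<open>elementary_desync_powers\<close>). To see this, let \<open>r\<close> be the part of a letter image of \<open>y\<close> which remains to
  be read at a cut of \<open>x\<close>. There are finitely many such words, so one, \<open>r\<close>, recurs, and the
  stretches between its occurrences satisfy \<open>f(X) r = r f(Y)\<close>. Write the words \<open>f(a)\<close> and \<open>r\<close> over a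
  code \<open>B\<close> each of whose words begins one of them (\<open>code_hull\<close>). The relation makes \<open>r\<close> begin with the
  same word as some \<open>f(a)\<close>; as \<open>f\<close> is elementary, the words \<open>f(a)\<close> then have pairwise distinct first
  factors in \<open>B\<close>. Hence, once \<open>r\<close> is known, the two sides can be parsed deterministically as long as they have no common
  cut, so any two stretches are comparable as prefixes (\<open>elementary_conjugation_comparable\<close>). A
  long stretch without its short initial loop is thus a prefix of the long stretch, which makes it periodic.

  The morphism \<open>\<phi>\<close> itself need not be elementary. Among all sets \<open>B\<close> of words over which
  some power \<open>\<phi>\<^sup>n\<close>, \<open>n > 0\<close>, factors, choose one with as few words as possible. It gives
  \<open>\<phi>\<^sup>n = concat \<circ> g\<close>, and both \<open>concat\<close> on \<open>B\<close> and \<open>\<psi> = g \<circ> concat\<close> are elementary by minimality. In a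
  long covering for \<open>\<phi>\<close>, lifted along \<open>\<phi>\<^bsup>2n-1\<^esup>\<close>, either a long stretch has no common cut with respect to
  \<open>concat\<close>, or two \<open>B\<close>-words agree on a long stretch and there have no common cut with respect to
  \<open>\<psi>\<close>. The defect theorem applies in either case (\<open>desync_imp_powers\<close>). The repeated word contains an unbounded
  letter because bounded letters have images of length one, which would create common cuts
  (\<open>desync_factor_unbounded\<close>). Its length is bounded independently of the exponent, so one word
  serves for all exponents.
\<close>

section \<open>Words and letter-to-word morphisms\<close>

abbreviation word_power :: "'a list \<Rightarrow> nat \<Rightarrow> 'a list" where
  "word_power t k \<equiv> concat (replicate k t)"

definition extend :: "('a \<Rightarrow> 'b list) \<Rightarrow> 'a list \<Rightarrow> 'b list" where
  "extend f w = concat (map f w)"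

lemma extend_simps [simp]:
  "extend f [] = []" "extend f (a # w) = f a @ extend f w" "extend f (u @ v) = extend f u @ extend f v"
  by (simp_all add: extend_def)

lemma extend_concat: "extend f (concat ws) = concat (map (extend f) ws)"
  by (induction ws) auto

lemma extend_word_power: "extend f (word_power t k) = word_power (extend f t) k"
  by (induction k) auto

lemma extend_in_lists: "w \<in> lists A \<Longrightarrow> (\<And>a. a \<in> A \<Longrightarrow> f a \<in> lists B) \<Longrightarrow> extend f w \<in> lists B"
  by (induction w) auto

lemma prefix_extend: "prefix u v \<Longrightarrow> prefix (extend f u) (extend f v)"
  by (auto simp: prefix_def)

lemma sublist_extend: "sublist u v \<Longrightarrow> sublist (extend f u) (extend f v)"
  by (fastforce simp: sublist_def)

lemma length_extend_ge: "(\<And>a. a \<in> set w \<Longrightarrow> f a \<noteq> []) \<Longrightarrow> length w \<le> length (extend f w)"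
proof (induction w)
  case (Cons a w)
  then have "length w \<le> length (extend f w)" and "f a \<noteq> []" by auto
  then show ?case by (cases "f a") auto
qed simp

lemma length_extend_le: "(\<And>a. a \<in> set w \<Longrightarrow> length (f a) \<le> m) \<Longrightarrow> length (extend f w) \<le> m * length w"
  by (induction w) (auto simp: add_mono)

text \<open>
  A strictly longer word has a strictly longer image.
\<close>

lemma extend_prefix_eq:
  assumes "prefix u v" "\<And>a. a \<in> set v \<Longrightarrow> f a \<noteq> []" "length (extend f v) \<le> length (extend f u)"
  shows "u = v"
proof -
  obtain w where w: "v = u @ w" using assms(1) by (auto simp: prefix_def)
  have "length w \<le> length (extend f w)" by (rule length_extend_ge) (use assms(2) w in auto)
  then show ?thesis using assms(3) w by simp
qed

text \<open>
  The piece \<open>C\<close> is the rest of the letter image in which \<open>L\<close> ends. This lemma and the next two move a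
  factorization of an image to the nearest cuts.
\<close>

lemma extend_split_left:
  assumes "extend f X = L @ W" "\<And>a. a \<in> set X \<Longrightarrow> length (f a) \<le> m"
  shows "\<exists>X1 X2 C. X = X1 @ X2 \<and> extend f X1 = L @ C \<and> W = C @ extend f X2 \<and> length C \<le> m"
  using assms
proof (induction X arbitrary: L)
  case Nil
  then show ?case by auto
next
  case (Cons a X)
  have eq: "f a @ extend f X = L @ W" using Cons.prems(1) by simp
  show ?case
  proof (cases "length L \<le> length (f a)")
    case True
    then obtain C where C: "f a = L @ C" "W = C @ extend f X"
      using eq by (auto simp: append_eq_append_conv2)
    have "length C \<le> m" using Cons.prems(2)[of a] C by simp
    then show ?thesis using C by (intro exI[of _ "[a]"] exI[of _ X] exI[of _ C]) auto
  next
    case False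
    then obtain L' where L': "L = f a @ L'" "extend f X = L' @ W"
      using eq by (auto simp: append_eq_append_conv2)
    then obtain X1 X2 C where "X = X1 @ X2" "extend f X1 = L' @ C" "W = C @ extend f X2" "length C \<le> m"
      using Cons.IH[of L'] Cons.prems(2) by auto
    then show ?thesis using L' by (intro exI[of _ "a # X1"] exI[of _ X2] exI[of _ C]) auto
  qed
qed

lemma extend_split_right:
  assumes "extend f X = W @ R" "\<And>a. a \<in> set X \<Longrightarrow> length (f a) \<le> m"
  shows "\<exists>X1 X2 C. X = X1 @ X2 \<and> extend f X2 = C @ R \<and> W = extend f X1 @ C \<and> length C \<le> m"
  using assms
proof (induction X arbitrary: R rule: rev_induct)
  case Nil
  then show ?case by auto
next
  case (snoc a X)
  have eq: "extend f X @ f a = W @ R" using snoc.prems(1) by simp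
  show ?case
  proof (cases "length R \<le> length (f a)")
    case True
    have "length (extend f X) + length (f a) = length W + length R" using arg_cong[OF eq, of length] by simp
    then have "length (extend f X) \<le> length W" using True by linarith
    then obtain C where C: "f a = C @ R" "W = extend f X @ C"
      using eq by (auto simp: append_eq_append_conv2)
    have "length C \<le> m" using snoc.prems(2)[of a] C by simp
    then show ?thesis using C by (intro exI[of _ X] exI[of _ "[a]"] exI[of _ C]) auto
  next
    case False
    have "length (extend f X) + length (f a) = length W + length R" using arg_cong[OF eq, of length] by simp
    then have "length W < length (extend f X)" using False by linarith
    then obtain R' where R': "R = R' @ f a" "extend f X = W @ R'"
      using eq by (auto simp: append_eq_append_conv2)
    then obtain X1 X2 C where "X = X1 @ X2" "extend f X2 = C @ R'" "W = extend f X1 @ C" "length C \<le> m"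
      using snoc.IH[of R'] snoc.prems(2) by auto
    then show ?thesis using R' by (intro exI[of _ X1] exI[of _ "X2 @ [a]"] exI[of _ C]) auto
  qed
qed

text \<open>
  A factor \<open>M\<close> of an image contains the whole image of a factor of the preimage, up to one incomplete
  letter image at either end. If \<open>M\<close> were shorter than a letter image, it could lie strictly inside
  of one.
\<close>

lemma extend_trim:
  assumes eq: "extend f X = L @ M @ R" and m: "\<And>a. a \<in> set X \<Longrightarrow> length (f a) \<le> m"
    and long: "m \<le> length M"
  obtains X1 X2 X3 M1 M2 where "X = X1 @ X2 @ X3" "M = M1 @ extend f X2 @ M2"
    "extend f X1 = L @ M1" "extend f X3 = M2 @ R" "length M \<le> m * (length X2 + 2)"
proof -
  obtain X1 X' C where 1: "X = X1 @ X'" "extend f X1 = L @ C" "M @ R = C @ extend f X'" "length C \<le> m"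
    using extend_split_left[OF eq m] by auto
  have "length C \<le> length M" using 1(4) long by simp
  then obtain W where W: "M = C @ W" "extend f X' = W @ R"
    using 1(3) by (auto simp: append_eq_append_conv2)
  obtain X2 X3 C' where 2: "X' = X2 @ X3" "extend f X3 = C' @ R" "W = extend f X2 @ C'" "length C' \<le> m"
    using extend_split_right[OF W(2), of m] m 1(1) by auto
  have "length (extend f X2) \<le> m * length X2" by (rule length_extend_le) (use m 1 2 in auto)
  then have "length M \<le> m * (length X2 + 2)" using W 1 2 by simp
  then show thesis using that[of X1 X2 X3 C C'] 1 2 W by auto
qed

lemma word_power_add: "word_power t (i + j) = word_power t i @ word_power t j"
  by (simp add: replicate_add)

lemma length_word_power: "length (word_power t k) = k * length t"
  by (induction k) auto

lemma prefix_word_power_mono: "i \<le> j \<Longrightarrow> prefix (word_power t i) (word_power t j)"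
  by (metis le_Suc_ex prefixI word_power_add)

text \<open>
  A word that is a prefix of itself after removal of its prefix \<open>t\<close> is periodic with period \<open>t\<close>.
\<close>

lemma prefix_word_power:
  assumes "X = t @ X'" "prefix X' X" "k * length t \<le> length X"
  shows "prefix (word_power t k) X"
  using assms(3)
proof (induction k)
  case (Suc k)
  have "prefix (word_power t k) X" using Suc by simp
  moreover have "length (word_power t k) \<le> length X'"
    using Suc.prems assms(1) by (simp add: length_word_power)
  ultimately have "prefix (word_power t k) X'"
    using assms(2) prefix_length_prefix by blast
  then show ?case using assms(1) by simp
qed simp

lemma finite_words_upto: "finite A \<Longrightarrow> finite {w. w \<in> lists A \<and> length w \<le> n}"
  using finite_lists_length_le[of A n] by (simp add: lists_eq_set)

section \<open>Code hulls and elementary families of words\<close>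

definition blocks_avoiding :: "'a list set \<Rightarrow> 'a list \<Rightarrow> 'a list set" where
  "blocks_avoiding B b = {c @ word_power b k |c k. c \<in> B - {b}}"

lemma blocks_avoidingI: "c \<in> B \<Longrightarrow> c \<noteq> b \<Longrightarrow> c @ word_power b k \<in> blocks_avoiding B b"
  unfolding blocks_avoiding_def by (rule CollectI) (intro exI conjI, rule refl, simp)

lemma blocks_avoidingE:
  assumes "w \<in> blocks_avoiding B b"
  obtains c k where "w = c @ word_power b k" "c \<in> B - {b}"
  using assms unfolding blocks_avoiding_def by (elim CollectE exE conjE)

text \<open>
  If a product over \<open>B\<close> does not start with \<open>b\<close>, then every occurrence of \<open>b\<close> can be attached to the
  factor on its left. This saves factors as soon as \<open>b\<close> occurs.
\<close>

lemma regroup_avoiding: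
  assumes "l \<in> lists B" "l \<noteq> [] \<Longrightarrow> hd l \<noteq> b"
  shows "\<exists>l2 \<in> lists (blocks_avoiding B b).
    concat l2 = concat l \<and> length l2 \<le> length l \<and> (b \<in> set l \<longrightarrow> length l2 < length l)"
  using assms
proof (induction l rule: rev_induct)
  case Nil
  then show ?case by auto
next
  case (snoc c l)
  let ?B2 = "blocks_avoiding B b"
  have "l \<noteq> [] \<Longrightarrow> hd l \<noteq> b" using snoc.prems(2) by simp
  then obtain l2 where l2: "l2 \<in> lists ?B2" "concat l2 = concat l" "length l2 \<le> length l"
    "b \<in> set l \<longrightarrow> length l2 < length l" using snoc by auto
  show ?case
  proof (cases "c = b")
    case False
    have "c @ word_power b 0 \<in> ?B2" using False snoc.prems(1) by (intro blocks_avoidingI) auto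
    then have "c \<in> ?B2" by simp
    then show ?thesis using l2 False by (intro bexI[of _ "l2 @ [c]"]) auto
  next
    case True
    have ne: "l \<noteq> []" using snoc.prems(2) True by auto
    have "hd l \<noteq> b" "hd l \<in> B" using ne snoc.prems by (auto simp: hd_append)
    show ?thesis
    proof (cases l2 rule: rev_cases)
      case Nil
      then have "concat l = []" using l2 by simp
      then have "concat (l @ [c]) = concat [hd l @ word_power b 1]"
        using ne True by (cases l) auto
      moreover have "hd l @ word_power b 1 \<in> ?B2"
        using \<open>hd l \<noteq> b\<close> \<open>hd l \<in> B\<close> by (intro blocks_avoidingI)
      ultimately show ?thesis using ne by (intro bexI[of _ "[hd l @ word_power b 1]"]) (cases l; auto)+
    next
      case (snoc l3 d)
      then have "d \<in> ?B2" using l2(1) by simp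
      then obtain e k where d: "d = e @ word_power b k" "e \<in> B - {b}" by (rule blocks_avoidingE)
      have "e @ word_power b (Suc k) \<in> ?B2" using d(2) by (intro blocks_avoidingI) auto
      moreover have "e @ word_power b (Suc k) = d @ b"
        using d word_power_add[of k 1 b] by simp
      ultimately have "d @ b \<in> ?B2" by metis
      then show ?thesis using l2 snoc True by (intro bexI[of _ "l3 @ [d @ b]"]) auto
    qed
  qed
qed

text \<open>
  A letter different from \<open>b\<close> announces the beginning of each block.
\<close>

lemma marked_blocks_unique:
  assumes "\<forall>(c, k) \<in> set zs. c \<noteq> b" "\<forall>(c, k) \<in> set zs'. c \<noteq> b"
    and "concat (map (\<lambda>(c, k). c # replicate k b) zs) = concat (map (\<lambda>(c, k). c # replicate k b) zs')"
  shows "zs = zs'"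
  using assms
proof (induction zs arbitrary: zs')
  case Nil
  then show ?case by (cases zs') auto
next
  case (Cons x zs)
  obtain c k where x: "x = (c, k)" by force
  obtain x' zs'' where zs': "zs' = x' # zs''" using Cons.prems(3) x by (cases zs') auto
  obtain c' k' where x': "x' = (c', k')" by force
  let ?e = "\<lambda>zs. concat (map (\<lambda>(c, k). c # replicate k b) zs)"
  have tw: "takeWhile (\<lambda>a. a = b) (?e ws) = []"
    if "\<forall>(c, k) \<in> set ws. c \<noteq> b" for ws
    using that by (cases ws) auto
  have tr: "takeWhile (\<lambda>a. a = b) (replicate i b @ ?e ws) = replicate i b"
    if "\<forall>(c, k) \<in> set ws. c \<noteq> b" for ws i
    using tw[OF that] by (induction i) auto
  have eq: "c = c'" "replicate k b @ ?e zs = replicate k' b @ ?e zs''"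
    using Cons.prems(3) x x' zs' by auto
  have "replicate k b = replicate k' b"
    using tr[of zs k] tr[of zs'' k'] Cons.prems(1,2) zs' eq(2) by simp
  then have "k = k'" by (metis length_replicate)
  then have "?e zs = ?e zs''" using eq(2) by simp
  then have "zs = zs''" using Cons.IH[of zs''] Cons.prems zs' by simp
  then show ?case using x x' zs' eq \<open>k = k'\<close> by simp
qed

lemma blocks_avoiding_code:
  assumes inj: "inj_on concat (lists B)" and b: "b \<in> B"
  shows "inj_on concat (lists (blocks_avoiding B b))"
proof (rule inj_onI)
  let ?B2 = "blocks_avoiding B b"
  let ?e = "\<lambda>zs. concat (map (\<lambda>(c, k). c # replicate k b) zs)"
  let ?w = "\<lambda>zs. map (\<lambda>(c, k). c @ word_power b k) zs"
  have dec: "\<exists>zs. l = ?w zs \<and> (\<forall>(c, k) \<in> set zs. c \<in> B - {b})" if "l \<in> lists ?B2" for l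
    using that
  proof (induction l)
    case (Cons a l)
    then obtain zs where "l = ?w zs" "\<forall>(c, k) \<in> set zs. c \<in> B - {b}" by auto
    moreover obtain c k where "a = c @ word_power b k" "c \<in> B - {b}"
      using Cons.hyps(1) by (rule blocks_avoidingE)
    ultimately show ?case by (intro exI[of _ "(c, k) # zs"]) auto
  qed auto
  fix l l' assume l: "l \<in> lists ?B2" "l' \<in> lists ?B2" "concat l = concat l'"
  obtain zs where zs: "l = ?w zs" "\<forall>(c, k) \<in> set zs. c \<in> B - {b}" using dec[OF l(1)] by blast
  obtain zs' where zs': "l' = ?w zs'" "\<forall>(c, k) \<in> set zs'. c \<in> B - {b}" using dec[OF l(2)] by blast
  have cc: "concat (?e ws) = concat (?w ws)" for ws by (induction ws) auto
  have eB: "?e ws \<in> lists B" if "\<forall>(c, k) \<in> set ws. c \<in> B - {b}" for ws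
    using that b by (induction ws) (auto simp: in_lists_conv_set)
  have "?e zs = ?e zs'"
    using inj_onD[OF inj _ eB[OF zs(2)] eB[OF zs'(2)]] cc l(3) zs zs' by simp
  then have "zs = zs'" by (intro marked_blocks_unique[of zs b zs']) (use zs zs' in auto)
  then show "l = l'" using zs zs' by simp
qed

text \<open>
  The words of \<open>Y\<close> are written over a code with as few factors as possible. If some code word \<open>b\<close>
  occurred but never in first position, then the code \<open>blocks_avoiding B b\<close> would need fewer factors. Every
  code word that occurs is therefore a first factor, so the code has at most as many words as
  \<open>Y\<close>, and fewer if two words of \<open>Y\<close> share their first factor. All defect arguments below rest on this.
\<close>

lemma code_hull:
  assumes fin: "finite Y" and ne: "[] \<notin> Y"
  obtains B g where "[] \<notin> B" "inj_on concat (lists B)"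
    "\<And>y. y \<in> Y \<Longrightarrow> g y \<in> lists B \<and> concat (g y) = y" "B = (\<lambda>y. hd (g y)) ` Y"
proof -
  define ok where "ok = (\<lambda>(B, g). [] \<notin> B \<and> inj_on concat (lists B) \<and>
    (\<forall>y \<in> Y. g y \<in> lists B \<and> concat (g y) = y))"
  define size where "size = (\<lambda>(B :: 'a list set, g :: 'a list \<Rightarrow> 'a list list). \<Sum>y\<in>Y. length (g y))"
  \<comment> \<open>The one-letter words form a code, so the minimum is taken over a nonempty family.\<close>
  have "ok (range (\<lambda>c. [c]), \<lambda>y. map (\<lambda>c. [c]) y)"
  proof -
    have "inj_on concat (lists (range (\<lambda>c::'a. [c])))"
    proof (rule inj_onI)
      have *: "l = map (\<lambda>c. [c]) (concat l)" if "l \<in> lists (range (\<lambda>c::'a. [c]))" for l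
        using that by (induction l) auto
      fix l l' assume "l \<in> lists (range (\<lambda>c::'a. [c]))" "l' \<in> lists (range (\<lambda>c::'a. [c]))" "concat l = concat l'"
      then show "l = l'" using *[of l] *[of l'] by simp
    qed
    moreover have "concat (map (\<lambda>c. [c]) y) = y" for y :: "'a list" by (induction y) auto
    ultimately show ?thesis by (auto simp: ok_def)
  qed
  then obtain H where "ok H" "\<And>H'. ok H' \<Longrightarrow> size H \<le> size H'"
    using ex_has_least_nat[of ok _ size] by blast
  moreover obtain B g where "H = (B, g)" by force
  ultimately have ok: "ok (B, g)" and least: "\<And>B' g'. ok (B', g') \<Longrightarrow> size (B, g) \<le> size (B', g')"
    by auto
  \<comment> \<open>Code words that occur in no decomposition are discarded: the set of first factors is enough.\<close>
  define U where "U = (\<lambda>y. hd (g y)) ` Y"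
  have gne: "g y \<noteq> []" if "y \<in> Y" for y using ok that ne unfolding ok_def by (cases "g y") auto
  have gU: "g y \<in> lists U" if y: "y \<in> Y" for y
  proof (rule ccontr)
    assume "g y \<notin> lists U"
    then obtain b where b: "b \<in> set (g y)" "b \<notin> U" by auto
    have bB: "b \<in> B" using ok y b unfolding ok_def by auto
    let ?B2 = "blocks_avoiding B b"
    have "\<forall>z \<in> Y. \<exists>l2. l2 \<in> lists ?B2 \<and> concat l2 = concat (g z) \<and> length l2 \<le> length (g z)
        \<and> (b \<in> set (g z) \<longrightarrow> length l2 < length (g z))"
    proof
      fix z assume z: "z \<in> Y"
      show "\<exists>l2. l2 \<in> lists ?B2 \<and> concat l2 = concat (g z) \<and> length l2 \<le> length (g z)
        \<and> (b \<in> set (g z) \<longrightarrow> length l2 < length (g z))"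
      proof (rule regroup_avoiding[unfolded Bex_def])
        show "g z \<in> lists B" using ok z by (auto simp: ok_def)
        show "hd (g z) \<noteq> b" using b(2) z by (auto simp: U_def)
      qed
    qed
    then obtain g2 where g2: "\<forall>z \<in> Y. g2 z \<in> lists ?B2 \<and> concat (g2 z) = concat (g z)
        \<and> length (g2 z) \<le> length (g z) \<and> (b \<in> set (g z) \<longrightarrow> length (g2 z) < length (g z))"
      by (rule bchoice[THEN exE])
    have "ok (?B2, g2)"
      using ok g2 blocks_avoiding_code[OF _ bB] unfolding ok_def by (auto elim: blocks_avoidingE)
    then have "size (B, g) \<le> size (?B2, g2)" by (rule least)
    moreover have "size (?B2, g2) < size (B, g)"
      unfolding size_def prod.case by (rule sum_strict_mono_ex1[OF fin]) (use g2 y b in auto)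
    ultimately show False by simp
  qed
  have "U \<subseteq> B"
  proof
    fix b assume "b \<in> U"
    then obtain y where "y \<in> Y" "b = hd (g y)" by (auto simp: U_def)
    then show "b \<in> B" using ok gne[of y] unfolding ok_def by (cases "g y") auto
  qed
  show thesis
  proof (rule that[of U g])
    show "[] \<notin> U" using ok \<open>U \<subseteq> B\<close> by (auto simp: ok_def)
    show "inj_on concat (lists U)"
      using ok inj_on_subset[OF _ lists_mono[OF \<open>U \<subseteq> B\<close>]] unfolding ok_def by blast
    show "g y \<in> lists U \<and> concat (g y) = y" if "y \<in> Y" for y
      using gU[OF that] ok that by (auto simp: ok_def)
    show "U = (\<lambda>y. hd (g y)) ` Y" by (simp add: U_def)
  qed
qed

text \<open>
  Equivalently, \<open>f\<close> does not factor through a free monoid on fewer letters than \<open>A\<close> has. The set \<open>E\<close> of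
  words plays the role of the smaller alphabet, with concatenation as the second morphism.
\<close>

definition elementary_on :: "'a set \<Rightarrow> ('a \<Rightarrow> 'b list) \<Rightarrow> bool" where
  "elementary_on A f \<longleftrightarrow> (\<forall>E. finite E \<and> card E < card A \<longrightarrow> \<not> f ` A \<subseteq> concat ` lists E)"

text \<open>
  With distinct first factors, one factor of lookahead determines the next letter.
\<close>

lemma distinct_heads_diverge:
  assumes "inj_on (\<lambda>a. hd (h a)) A" "\<And>a. a \<in> A \<Longrightarrow> h a \<noteq> []" "a \<in> A" "b \<in> A"
    and "prefix (extend h (P @ [a])) W" "prefix (extend h (P @ [b])) W"
  shows "a = b"
proof -
  obtain u where "W = extend h P @ h a @ u" using assms(5) by (auto simp: prefix_def)
  moreover obtain v where "W = extend h P @ h b @ v" using assms(6) by (auto simp: prefix_def)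
  ultimately have "hd (h a @ u) = hd (h b @ v)" by simp
  then have "hd (h a) = hd (h b)" using assms(2-4) by (simp add: hd_append)
  then show ?thesis using assms(1,3,4) by (auto dest: inj_onD)
qed

lemma distinct_heads_prefix_comparable:
  assumes h: "inj_on (\<lambda>a. hd (h a)) A" "\<And>a. a \<in> A \<Longrightarrow> h a \<noteq> []"
    and XY: "X \<in> lists A" "Y \<in> lists A" "prefix (extend h X) W" "prefix (extend h Y) W"
  shows "prefix X Y \<or> prefix Y X"
proof (rule ccontr)
  assume "\<not> ?thesis"
  then obtain P a u b v where "a \<noteq> b" "X = P @ a # u" "Y = P @ b # v"
    using parallel_decomp[of X Y] by blast
  moreover have "a = b"
    by (rule distinct_heads_diverge[OF h, where P = P and W = W])
      (use calculation XY in \<open>auto simp: prefix_def\<close>)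
  ultimately show False by simp
qed

text \<open>
  The first factors form a set over which \<open>f\<close> factors; being elementary, \<open>f\<close> admits no such set with fewer words than \<open>A\<close>
  has letters.
\<close>

lemma elementary_heads_inj:
  assumes fin: "finite A" and el: "elementary_on A f"
    and B: "\<And>a. a \<in> A \<Longrightarrow> g (f a) \<in> lists B \<and> concat (g (f a)) = f a"
    and cover: "B = (\<lambda>a. hd (g (f a))) ` A"
  shows "inj_on (\<lambda>a. hd (g (f a))) A"
proof -
  have "finite B" using fin cover by simp
  have "f ` A \<subseteq> concat ` lists B"
  proof
    fix w assume "w \<in> f ` A"
    then obtain a where "a \<in> A" "w = f a" by auto
    then show "w \<in> concat ` lists B" using B[of a] by (intro image_eqI[of _ _ "g (f a)"]) auto
  qed
  then have "\<not> card B < card A" using el \<open>finite B\<close> unfolding elementary_on_def by blast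
  moreover have "card B \<le> card A" using cover card_image_le[OF fin] by blast
  ultimately show ?thesis using cover fin by (intro eq_card_imp_inj_on) auto
qed

lemma extend_decomposition:
  assumes "\<And>a. a \<in> A \<Longrightarrow> g (f a) \<in> lists B \<and> concat (g (f a)) = f a" "x \<in> lists A"
  shows "extend (\<lambda>a. g (f a)) x \<in> lists B \<and> concat (extend (\<lambda>a. g (f a)) x) = extend f x"
  using assms(2) by (induction x) (use assms(1) in auto)

lemma elementary_imp_inj_extend:
  assumes fin: "finite A" and el: "elementary_on A f" and ne: "\<And>a. a \<in> A \<Longrightarrow> f a \<noteq> []"
  shows "inj_on (extend f) (lists A)"
proof (rule inj_onI)
  have "[] \<notin> f ` A" using ne by force
  then obtain B g where B: "[] \<notin> B" "inj_on concat (lists B)"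
    "\<And>y. y \<in> f ` A \<Longrightarrow> g y \<in> lists B \<and> concat (g y) = y" "B = (\<lambda>y. hd (g y)) ` f ` A"
    using code_hull[of "f ` A"] fin by blast
  let ?h = "\<lambda>a. g (f a)"
  have gB: "g (f a) \<in> lists B \<and> concat (g (f a)) = f a" if "a \<in> A" for a using B(3) that by blast
  have heads: "inj_on (\<lambda>a. hd (?h a)) A"
    by (rule elementary_heads_inj[OF fin el gB]) (use B(4) in \<open>auto simp: image_image\<close>)
  have hne: "?h a \<noteq> []" if "a \<in> A" for a using gB[OF that] ne[OF that] by auto
  have inj_h: "u = v" if "u \<in> lists A" "v \<in> lists A" "prefix u v" "extend ?h u = extend ?h v" for u v
    by (rule extend_prefix_eq[of u v ?h]) (use that hne in auto)
  fix x y assume xy: "x \<in> lists A" "y \<in> lists A" "extend f x = extend f y"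
  have "extend ?h x = extend ?h y"
    using extend_decomposition[of A g f B, OF gB xy(1)] extend_decomposition[of A g f B, OF gB xy(2)] xy(3)
    by (intro inj_onD[OF B(2)]) auto
  moreover have "prefix x y \<or> prefix y x"
    by (rule distinct_heads_prefix_comparable[OF heads hne xy(1,2), of "extend ?h x"])
      (use calculation in auto)
  ultimately show "x = y" using inj_h[of x y] inj_h[of y x] xy by auto
qed

lemma prefix_next_letter: "prefix (u @ c # w) (u @ v @ z) \<Longrightarrow> v \<noteq> [] \<Longrightarrow> c = hd v"
  by (cases v) auto

text \<open>
  A solution \<open>X\<close> of \<open>f(X) r = r f(Y)\<close> without common cut is determined by \<open>r\<close> up to its length. In the hull of the
  words \<open>f(a)\<close> and \<open>r\<close>, the first factor of \<open>r\<close> is that of some \<open>f(a)\<close>, so the first factors of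
  the \<open>f(a)\<close> exhaust the hull and are distinct. If \<open>X\<close> and \<open>X'\<close> branched after a common prefix
  \<open>P\<close>, then the hull decompositions of \<open>f(X) r\<close> and \<open>f(X') r\<close> would agree exactly up to the image of \<open>P\<close>. Reading the same two words
  as \<open>r f(Y)\<close> and \<open>r f(Y')\<close>, they agree exactly up to the image of a common prefix \<open>Q\<close> of \<open>Y\<close> and \<open>Y'\<close>. The
  two positions coincide, and this is a common cut.
\<close>

lemma elementary_conjugation_comparable:
  assumes fin: "finite A" and el: "elementary_on A f" and ne: "\<And>a. a \<in> A \<Longrightarrow> f a \<noteq> []"
    and r: "r \<noteq> []" and X: "X \<in> lists A" "X \<noteq> []" "X' \<in> lists A"
    and Y: "Y \<in> lists A" "Y' \<in> lists A"
    and eq: "extend f X @ r = r @ extend f Y" "extend f X' @ r = r @ extend f Y'"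
    and no_cut: "\<And>P Q. prefix P X \<Longrightarrow> prefix Q Y \<Longrightarrow> extend f P \<noteq> r @ extend f Q"
  shows "prefix X X' \<or> prefix X' X"
proof (rule ccontr)
  assume neg: "\<not> ?thesis"
  have "[] \<notin> insert r (f ` A)" using ne r by force
  then obtain B g where B: "[] \<notin> B" "inj_on concat (lists B)"
    "\<And>y. y \<in> insert r (f ` A) \<Longrightarrow> g y \<in> lists B \<and> concat (g y) = y"
    "B = (\<lambda>y. hd (g y)) ` insert r (f ` A)"
    using code_hull[of "insert r (f ` A)"] fin by blast
  let ?h = "\<lambda>a. g (f a)"
  have gB: "g (f a) \<in> lists B \<and> concat (g (f a)) = f a" if "a \<in> A" for a using B(3) that by blast
  have gr: "g r \<in> lists B" "concat (g r) = r" using B(3) by auto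
  have dec: "extend ?h w \<in> lists B" "concat (extend ?h w) = extend f w" if "w \<in> lists A" for w
    using extend_decomposition[of A g f B, OF gB that] by auto
  have hne: "?h a \<noteq> []" if "a \<in> A" for a using gB[OF that] ne[OF that] by auto
  have lift: "extend ?h U @ g r = g r @ extend ?h V"
    if "U \<in> lists A" "V \<in> lists A" "extend f U @ r = r @ extend f V" for U V
    using dec[OF that(1)] dec[OF that(2)] gr that(3) by (intro inj_onD[OF B(2)]) auto
  have hX: "extend ?h X @ g r = g r @ extend ?h Y" and hX': "extend ?h X' @ g r = g r @ extend ?h Y'"
    using lift X Y eq by blast+
  obtain a0 X0 where a0: "X = a0 # X0" using X(2) by (cases X) auto
  have "g r \<noteq> []" using gr r by auto
  then have "hd (g r) = hd (?h a0)"
    using arg_cong[OF hX, of hd] a0 hne[of a0] X(1) by simp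
  then have cover: "B = (\<lambda>a. hd (?h a)) ` A" using B(4) a0 X(1) by (auto simp: image_image)
  have heads: "inj_on (\<lambda>a. hd (?h a)) A"
    by (rule elementary_heads_inj[OF fin el gB cover])
  obtain P a u a' u' where P: "a \<noteq> a'" "X = P @ a # u" "X' = P @ a' # u'"
    using parallel_decomp[of X X'] neg by blast
  have aA: "a \<in> A" "a' \<in> A" using P X by auto
  \<comment> \<open>Nothing longer than the image of the common prefix is a prefix of both sides.\<close>
  have split_at_P: "W = extend ?h P"
    if W: "prefix W (extend ?h X @ g r)" "prefix W (extend ?h X' @ g r)" "prefix (extend ?h P) W" for W
  proof (rule ccontr)
    assume "W \<noteq> extend ?h P"
    then obtain c w where cw: "W = extend ?h P @ c # w" using W(3) by (metis append_Nil2 neq_Nil_conv prefix_def)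
    have next_letters: "prefix (extend ?h P @ c # w) (extend ?h P @ ?h a @ extend ?h u @ g r)"
      "prefix (extend ?h P @ c # w) (extend ?h P @ ?h a' @ extend ?h u' @ g r)"
      using W(1,2) P(2,3) cw by auto
    then have "c = hd (?h a)" "c = hd (?h a')"
      using prefix_next_letter[OF next_letters(1) hne[OF aA(1)]]
        prefix_next_letter[OF next_letters(2) hne[OF aA(2)]] by simp_all
    then show False using heads aA P(1) by (auto dest: inj_onD)
  qed
  have long: "length (extend ?h P) < length (extend ?h X)" "length (extend ?h P) < length (extend ?h X')"
    using P hne aA by auto
  have "\<not> prefix Y Y'"
  proof
    assume "prefix Y Y'"
    then have "prefix (extend ?h X @ g r) (extend ?h X' @ g r)" unfolding hX hX' by (auto dest: prefix_extend)
    then have "extend ?h X @ g r = extend ?h P" using P by (intro split_at_P) auto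
    then show False using long by (metis length_append not_add_less1)
  qed
  moreover have "\<not> prefix Y' Y"
  proof
    assume "prefix Y' Y"
    then have "prefix (extend ?h X' @ g r) (extend ?h X @ g r)" unfolding hX hX' by (auto dest: prefix_extend)
    then have "extend ?h X' @ g r = extend ?h P" using P by (intro split_at_P) auto
    then show False using long by (metis length_append not_add_less1)
  qed
  ultimately obtain Q b v b' v' where Q: "b \<noteq> b'" "Y = Q @ b # v" "Y' = Q @ b' # v'"
    using parallel_decomp[of Y Y'] by blast
  have bA: "b \<in> A" "b' \<in> A" using Q Y by auto
  have P_pre: "prefix (extend ?h P) (extend ?h X @ g r)" "prefix (extend ?h P) (extend ?h X' @ g r)"
    using P by auto
  have Q_pre: "prefix (g r @ extend ?h Q) (extend ?h X @ g r)" "prefix (g r @ extend ?h Q) (extend ?h X' @ g r)"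
    unfolding hX hX' using Q by auto
  have "extend ?h P = g r @ extend ?h Q"
  proof (cases "prefix (extend ?h P) (g r @ extend ?h Q)")
    case True
    then show ?thesis using split_at_P[OF Q_pre] by simp
  next
    case False
    then have "prefix (g r @ extend ?h Q) (extend ?h P)"
      using prefix_same_cases[OF P_pre(1) Q_pre(1)] by blast
    then obtain d where d: "extend ?h P = (g r @ extend ?h Q) @ d" by (auto simp: prefix_def)
    with False obtain c w where "d = c # w" by (cases d) auto
    with d have cw: "extend ?h P = (g r @ extend ?h Q) @ c # w" by simp
    have next_letters: "prefix ((g r @ extend ?h Q) @ c # w) ((g r @ extend ?h Q) @ ?h b @ extend ?h v)"
      "prefix ((g r @ extend ?h Q) @ c # w) ((g r @ extend ?h Q) @ ?h b' @ extend ?h v')"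
      using P_pre Q(2,3) unfolding cw hX hX' by auto
    then have "c = hd (?h b)" "c = hd (?h b')"
      using prefix_next_letter[OF next_letters(1) hne[OF bA(1)]]
        prefix_next_letter[OF next_letters(2) hne[OF bA(2)]] by simp_all
    then show ?thesis using heads bA Q(1) by (auto dest: inj_onD)
  qed
  then have "concat (extend ?h P) = concat (g r @ extend ?h Q)" by simp
  moreover have "P \<in> lists A" "Q \<in> lists A" using P Q X Y by auto
  ultimately have "extend f P = r @ extend f Q" using dec gr by simp
  then show False using no_cut[of P Q] P Q by auto
qed

section \<open>Coverings without a common cut\<close>

text \<open>
  The word \<open>f(y)\<close> covers \<open>f(x)\<close> at offset \<open>|p|\<close>, and no cut of \<open>x\<close>, the two ends included, coincides with
  a cut of \<open>y\<close>. Two cuts of the same word \<open>f(y)\<close> coincide if and only if the prefixes that end there are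
  equal, so cuts are compared as words rather than as positions.
\<close>

definition desync :: "('a \<Rightarrow> 'b list) \<Rightarrow> 'a list \<Rightarrow> 'a list \<Rightarrow> 'b list \<Rightarrow> 'b list \<Rightarrow> bool" where
  "desync f x y p s \<longleftrightarrow> extend f y = p @ extend f x @ s \<and>
     (\<forall>P Q. prefix P x \<longrightarrow> prefix Q y \<longrightarrow> p @ extend f P \<noteq> extend f Q)"

lemma desync_sublist:
  assumes "desync f (u @ x @ v) y p s"
  shows "desync f x y (p @ extend f u) (extend f v @ s)"
proof -
  have "p @ extend f u @ extend f P \<noteq> extend f Q" if "prefix P x" "prefix Q y" for P Q
  proof -
    have "prefix (u @ P) (u @ x @ v)" using that(1) by (simp add: prefix_prefix)
    then have "p @ extend f (u @ P) \<noteq> extend f Q" using assms that(2) unfolding desync_def by blast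
    then show ?thesis by simp
  qed
  then show ?thesis using assms by (auto simp: desync_def)
qed

text \<open>
  A prefix of \<open>f(y)\<close> that does not end at a cut ends strictly inside the image of a letter \<open>b\<close>, and \<open>r\<close> is
  what remains of that image.
\<close>

lemma covering_letter:
  assumes "prefix w (extend f y)" "\<And>Q. prefix Q y \<Longrightarrow> w \<noteq> extend f Q"
  obtains Q b r where "prefix (Q @ [b]) y" "w @ r = extend f (Q @ [b])" "r \<noteq> []" "suffix r (f b)"
proof -
  have "\<exists>Q b r. prefix (Q @ [b]) y \<and> w @ r = extend f (Q @ [b]) \<and> r \<noteq> [] \<and> suffix r (f b)"
    using assms
  proof (induction y rule: rev_induct)
    case Nil
    then show ?case by fastforce
  next
    case (snoc b y)
    show ?case
    proof (cases "prefix w (extend f y)")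
      case True
      then show ?thesis using snoc.IH snoc.prems(2) by (metis prefix_prefix)
    next
      case False
      then obtain w' where w': "w = extend f y @ w'" "prefix w' (f b)"
        using snoc.prems(1) by (auto simp: prefix_append)
      then obtain r where r: "f b = w' @ r" by (auto simp: prefix_def)
      have "w \<noteq> extend f (y @ [b])" using snoc.prems(2) by blast
      then have "r \<noteq> []" using w' r by auto
      then show ?thesis using w' r by (intro exI[of _ y] exI[of _ b] exI[of _ r]) (auto simp: suffix_def)
    qed
  qed
  then show thesis using that by blast
qed

text \<open>
  Some state is visited at two times close to each other and again much later. The time axis contains
  \<open>card S + 1\<close> windows of \<open>card S + 1\<close> consecutive times each, any two at distance more than \<open>q\<close>. Each window repeats a
  state, and two windows repeat the same one.
\<close>

lemma recurring_state:
  fixes c :: "nat \<Rightarrow> 'c"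
  assumes fin: "finite S" and c: "\<And>i. i \<le> (card S + 1) * (card S + q + 1) \<Longrightarrow> c i \<in> S"
  obtains i j e where "i < j" "j \<le> i + card S" "j + q \<le> e" "e \<le> (card S + 1) * (card S + q + 1)"
    "c i = c j" "c j = c e"
proof -
  let ?K = "card S"
  have inS: "c (k * (?K + q + 1) + d) \<in> S" if "k \<le> ?K" "d \<le> ?K" for k d
  proof (rule c)
    have "k * (?K + q + 1) \<le> ?K * (?K + q + 1)" using that by (intro mult_right_mono) auto
    then show "k * (?K + q + 1) + d \<le> (?K + 1) * (?K + q + 1)" using that by simp
  qed
  have "\<exists>a b. a < b \<and> b \<le> ?K \<and> c (k * (?K + q + 1) + a) = c (k * (?K + q + 1) + b)" if k: "k \<le> ?K" for k
  proof -
    have "\<not> inj_on (\<lambda>d. c (k * (?K + q + 1) + d)) {..?K}"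
    proof
      assume "inj_on (\<lambda>d. c (k * (?K + q + 1) + d)) {..?K}"
      then have "card {..?K} \<le> card S" using inS k fin by (intro card_inj_on_le) auto
      then show False by simp
    qed
    then obtain a b where ab: "a \<le> ?K" "b \<le> ?K" "a \<noteq> b"
      "c (k * (?K + q + 1) + a) = c (k * (?K + q + 1) + b)" by (auto simp: inj_on_def)
    then show ?thesis by (cases "a < b") (metis, metis linorder_neqE_nat)
  qed
  then obtain a b where ab: "\<And>k. k \<le> ?K \<Longrightarrow> a k < b k \<and> b k \<le> ?K \<and>
    c (k * (?K + q + 1) + a k) = c (k * (?K + q + 1) + b k)" by metis
  have "\<not> inj_on (\<lambda>k. c (k * (?K + q + 1) + a k)) {..?K}"
  proof
    assume "inj_on (\<lambda>k. c (k * (?K + q + 1) + a k)) {..?K}"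
    moreover have "(\<lambda>k. c (k * (?K + q + 1) + a k)) ` {..?K} \<subseteq> S"
    proof
      fix w assume "w \<in> (\<lambda>k. c (k * (?K + q + 1) + a k)) ` {..?K}"
      then obtain k where "k \<le> ?K" "w = c (k * (?K + q + 1) + a k)" by auto
      then show "w \<in> S" using inS[of k "a k"] ab[of k] by simp
    qed
    ultimately have "card {..?K} \<le> card S" using fin card_inj_on_le by blast
    then show False by simp
  qed
  then obtain k l where "k \<le> ?K" "l \<le> ?K" "k \<noteq> l"
    "c (k * (?K + q + 1) + a k) = c (l * (?K + q + 1) + a l)" by (auto simp: inj_on_def)
  then obtain k l where kl: "k < l" "l \<le> ?K" "c (k * (?K + q + 1) + a k) = c (l * (?K + q + 1) + a l)"
    by (metis linorder_neqE_nat)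
  have "Suc k * (?K + q + 1) \<le> l * (?K + q + 1)" using kl by (intro mult_right_mono) auto
  moreover have "l * (?K + q + 1) \<le> ?K * (?K + q + 1)" using kl by (intro mult_right_mono) auto
  ultimately show thesis
    using ab[of k] ab[of l] kl
    by (intro that[of "k * (?K + q + 1) + a k" "k * (?K + q + 1) + b k" "l * (?K + q + 1) + a l"]) auto
qed

text \<open>
  The defect theorem, in quantitative form. The state of a cut of \<open>x\<close> is the part of the covering letter image of \<open>y\<close> that lies to its
  right. Take cuts \<open>i < j\<close> close to each other and a distant cut \<open>e\<close>, all in the same state \<open>r\<close>. The stretches of
  \<open>x\<close> from \<open>i\<close> to \<open>e\<close> and from \<open>j\<close> to \<open>e\<close> both solve \<open>f(X) r = r f(Y)\<close>, so the second one is a prefix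
  of the first, which therefore has the short period \<open>j - i\<close>.
\<close>

lemma elementary_desync_powers:
  assumes fin: "finite A" and el: "elementary_on A f" and ne: "\<And>a. a \<in> A \<Longrightarrow> f a \<noteq> []"
  obtains K where "\<And>q. \<exists>N. \<forall>x y p s. x \<in> lists A \<longrightarrow> y \<in> lists A \<longrightarrow> desync f x y p s \<longrightarrow>
    N \<le> length x \<longrightarrow> (\<exists>t. t \<noteq> [] \<and> length t \<le> K \<and> sublist (word_power t q) x)"
proof -
  define S where "S = {r. r \<noteq> [] \<and> (\<exists>b \<in> A. suffix r (f b))}"
  have "S \<subseteq> (\<Union>b\<in>A. set (suffixes (f b)))" by (auto simp: S_def)
  then have finS: "finite S" by (rule finite_subset) (use fin in auto)
  have main: "\<exists>t. t \<noteq> [] \<and> length t \<le> card S \<and> sublist (word_power t q) x"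
    if x: "x \<in> lists A" and y: "y \<in> lists A" and d: "desync f x y p s"
      and N: "(card S + 1) * (card S + q * card S + 1) \<le> length x" for q x y p s
  proof -
    have "\<exists>Q r. prefix Q y \<and> p @ extend f (take i x) @ r = extend f Q \<and> r \<in> S" if "i \<le> length x" for i
    proof -
      have "extend f x = extend f (take i x) @ extend f (drop i x)" by (metis append_take_drop_id extend_simps(3))
      then have "prefix (p @ extend f (take i x)) (extend f y)" using d by (simp add: desync_def)
      moreover have "p @ extend f (take i x) \<noteq> extend f Q" if "prefix Q y" for Q
        using d that take_is_prefix unfolding desync_def by blast
      ultimately obtain Q b r where Q: "prefix (Q @ [b]) y" "(p @ extend f (take i x)) @ r = extend f (Q @ [b])"
        "r \<noteq> []" "suffix r (f b)" by (rule covering_letter)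
      have "b \<in> A" using Q(1) y by (auto simp: prefix_def)
      then have "r \<in> S" using Q by (auto simp: S_def)
      then show ?thesis using Q by (intro exI[of _ "Q @ [b]"] exI[of _ r]) auto
    qed
    then obtain Q r where Q: "\<And>i. i \<le> length x \<Longrightarrow> prefix (Q i) y"
      "\<And>i. i \<le> length x \<Longrightarrow> p @ extend f (take i x) @ r i = extend f (Q i)"
      "\<And>i. i \<le> length x \<Longrightarrow> r i \<in> S" by metis
    obtain i j e where ije: "i < j" "j \<le> i + card S" "j + q * card S \<le> e" "e \<le> length x"
      "r i = r j" "r j = r e"
    proof (rule recurring_state[OF finS, of "q * card S" r])
      show "r i \<in> S" if "i \<le> (card S + 1) * (card S + q * card S + 1)" for i
        using Q(3)[of i] that N by simp
    qed (use N in auto)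
    have fne: "f a \<noteq> []" if "a \<in> set x \<union> set y" for a using ne that x y by auto
    \<comment> \<open>Two cuts in the same state give a conjugation relation between the stretches in between.\<close>
    have step: "\<exists>Z. Q e = Q k @ Z \<and> Z \<in> lists A \<and>
        extend f (drop k (take e x)) @ r e = r k @ extend f Z"
      if k: "k \<le> e" "r k = r e" for k
    proof -
      have tk: "take e x = take k x @ drop k (take e x)"
        using append_take_drop_id[of k "take e x"] k(1) by (simp add: min_def)
      have eqs: "p @ extend f (take k x) @ r e = extend f (Q k)"
        "p @ extend f (take k x) @ extend f (drop k (take e x)) @ r e = extend f (Q e)"
        using Q(2)[of k] Q(2)[of e] k ije(4) arg_cong[OF tk, of "extend f"] by auto
      have le: "length (extend f (Q k)) \<le> length (extend f (Q e))"
        unfolding eqs[symmetric] by simp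
      have "prefix (Q k) (Q e)"
      proof (cases "prefix (Q k) (Q e)")
        case False
        then have "prefix (Q e) (Q k)"
          using Q(1)[of k] Q(1)[of e] k ije(4) prefix_same_cases by fastforce
        then have "Q e = Q k" using le Q(1)[of k] k ije(4) fne
          by (intro extend_prefix_eq[of _ _ f]) (auto dest: set_mono_prefix)
        then show ?thesis by simp
      qed
      then obtain Z where Z: "Q e = Q k @ Z" by (auto simp: prefix_def)
      have "set Z \<subseteq> set y" using Z set_mono_prefix[OF Q(1)[OF ije(4)]] by simp
      then have "Z \<in> lists A" using y by auto
      moreover have "p @ extend f (take k x) @ extend f (drop k (take e x)) @ r e
          = p @ extend f (take k x) @ r e @ extend f Z"
        using eqs Z by (metis append.assoc extend_simps(3))
      ultimately show ?thesis using Z k by auto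
    qed
    let ?X = "drop i (take e x)" and ?X' = "drop j (take e x)" and ?t = "drop i (take j x)"
    obtain Y where Y: "Q e = Q i @ Y" "Y \<in> lists A" "extend f ?X @ r e = r e @ extend f Y"
      using step[of i] ije by auto
    obtain Y' where Y': "Q e = Q j @ Y'" "Y' \<in> lists A" "extend f ?X' @ r e = r e @ extend f Y'"
      using step[of j] ije by auto
    have XX': "?X = ?t @ ?X'"
    proof -
      have "take e x = take j x @ ?X'"
        using append_take_drop_id[of j "take e x"] ije by (simp add: min_def)
      then have "?X = drop i (take j x @ ?X')" by (rule arg_cong)
      also have "\<dots> = ?t @ ?X'" using ije by simp
      finally show ?thesis .
    qed
    have lens: "length ?t = j - i" "length ?X = e - i" using ije by auto
    have "prefix ?X ?X' \<or> prefix ?X' ?X"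
    proof (rule elementary_conjugation_comparable[OF fin el ne])
      show "r e \<noteq> []" using Q(3)[of e] ije by (auto simp: S_def)
      show "?X \<in> lists A" "?X' \<in> lists A" using x by (auto dest: in_set_takeD in_set_dropD)
      show "?X \<noteq> []" using ije by auto
      show "Y \<in> lists A" "Y' \<in> lists A" "extend f ?X @ r e = r e @ extend f Y" "extend f ?X' @ r e = r e @ extend f Y'"
        using Y Y' by auto
      show "extend f P \<noteq> r e @ extend f Z" if "prefix P ?X" "prefix Z Y" for P Z
      proof
        assume eq: "extend f P = r e @ extend f Z"
        have "take e x = take i x @ ?X"
          using append_take_drop_id[of i "take e x"] ije by (simp add: min_def)
        moreover have "prefix (take i x @ P) (take i x @ ?X)" using that(1) by simp
        ultimately have "prefix (take i x @ P) (take e x)" by (rule ssubst)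
        then have 1: "prefix (take i x @ P) x" using prefix_order.trans take_is_prefix by blast
        have "prefix (Q i @ Z) (Q e)" using Y(1) that(2) by simp
        then have 2: "prefix (Q i @ Z) y" using Q(1)[of e] ije prefix_order.trans by blast
        have "p @ extend f (take i x @ P) = extend f (Q i @ Z)"
          using eq Q(2)[of i] ije by (metis append.assoc extend_simps(3) le_add1 le_trans less_imp_le_nat)
        then show False using 1 2 d unfolding desync_def by blast
      qed
    qed
    then have "prefix ?X' ?X" using lens ije by (auto dest: prefix_length_le)
    moreover have "q * length ?t \<le> length ?X"
    proof -
      have "j - i \<le> card S" using ije by linarith
      then have "q * (j - i) \<le> q * card S" by (rule mult_le_mono2)
      then show ?thesis unfolding lens using ije by linarith
    qed
    ultimately have "prefix (word_power ?t q) ?X" using prefix_word_power[OF XX'] by blast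
    moreover have "sublist ?X x" by (metis sublist_drop sublist_order.order.trans sublist_take)
    ultimately have "sublist (word_power ?t q) x" using sublist_order.order.trans by blast
    moreover have "?t \<noteq> []" "length ?t \<le> card S" using lens ije by auto
    ultimately show ?thesis by blast
  qed
  show thesis
    by (rule that[of "card S"]) (use main in blast)
qed

text \<open>
  Between the first and the last common cut, injectivity makes the two words equal. Outside of them
  there is no common cut; one letter next to the extremal cut is dropped because a covering without common cut has to avoid
  its own ends too.
\<close>

lemma common_cut_or_desync:
  assumes inj: "inj_on (extend f) (lists A)" and ne: "\<And>a. a \<in> A \<Longrightarrow> f a \<noteq> []"
    and x: "x \<in> lists A" and y: "y \<in> lists A" and eq: "extend f y = p @ extend f x @ s"
  obtains (desync) "desync f x y p s"
  | (common) L M R Y1 Y2 where "x = L @ M @ R" "y = Y1 @ M @ Y2" "extend f Y1 = p @ extend f L"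
      "\<And>L' a. L = L' @ [a] \<Longrightarrow> desync f L' y p (f a @ extend f (M @ R) @ s)"
      "\<And>R' a. R = a # R' \<Longrightarrow> desync f R' y (p @ extend f (L @ M @ [a])) s"
proof (cases "desync f x y p s")
  case True
  then show ?thesis by (rule desync)
next
  case False
  define I where "I = {i. i \<le> length x \<and> (\<exists>Q. prefix Q y \<and> p @ extend f (take i x) = extend f Q)}"
  have inI: "length P \<in> I" if "prefix P x" "prefix Q y" "p @ extend f P = extend f Q" for P Q
    using that unfolding I_def by (auto simp: prefix_def)
  have "finite I" unfolding I_def by auto
  have "I \<noteq> {}" using False eq inI unfolding desync_def by blast
  let ?i = "Min I" and ?j = "Max I"
  have ij: "?i \<in> I" "?j \<in> I" "?i \<le> ?j" using \<open>finite I\<close> \<open>I \<noteq> {}\<close> by auto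
  have between: "?i \<le> k \<and> k \<le> ?j" if "k \<in> I" for k using that \<open>finite I\<close> by simp
  obtain Q where Q: "prefix Q y" "p @ extend f (take ?i x) = extend f Q" using ij(1) unfolding I_def by auto
  obtain Q' where Q': "prefix Q' y" "p @ extend f (take ?j x) = extend f Q'" using ij(2) unfolding I_def by auto
  have jx: "?j \<le> length x" using ij(2) unfolding I_def by auto
  define L M R where "L = take ?i x" and "M = drop ?i (take ?j x)" and "R = drop ?j x"
  have tj: "take ?j x = L @ M"
    using append_take_drop_id[of ?i "take ?j x"] ij(3) by (simp add: L_def M_def min_def)
  have xe: "x = L @ M @ R" using append_take_drop_id[of ?j x] tj by (simp add: R_def)
  have len: "length L = ?i" "length (L @ M) = ?j" using ij(3) jx tj[symmetric] by (auto simp: L_def)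
  have fne: "f a \<noteq> []" if "a \<in> set y" for a using that y ne by auto
  have "prefix Q Q'"
  proof (cases "prefix Q Q'")
    case False
    then have *: "prefix Q' Q" using Q(1) Q'(1) prefix_same_cases by blast
    have "length (extend f Q) \<le> length (extend f Q')"
      unfolding Q(2)[symmetric] Q'(2)[symmetric] tj L_def[symmetric] by simp
    then have "Q' = Q" using * fne set_mono_prefix[OF Q(1)]
      by (intro extend_prefix_eq[of _ _ f]) auto
    then show ?thesis by simp
  qed
  then obtain M' where M': "Q' = Q @ M'" by (auto simp: prefix_def)
  have "(p @ extend f L) @ extend f M = extend f Q @ extend f M'"
    using Q'(2) M' tj by simp
  then have "extend f M' = extend f M" using Q(2) by (simp add: L_def)
  moreover have "M' \<in> lists A" "M \<in> lists A"
    using M' set_mono_prefix[OF Q'(1)] y x xe by auto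
  ultimately have MM: "M' = M" using inj by (auto dest: inj_onD)
  obtain Y2 where ye: "y = Q @ M @ Y2" using Q'(1) M' MM by (auto simp: prefix_def)
  show ?thesis
  proof (rule common[OF xe ye])
    show "extend f Q = p @ extend f L" using Q(2) by (simp add: L_def)
    show "desync f L' y p (f a @ extend f (M @ R) @ s)" if "L = L' @ [a]" for L' a
    proof -
      have "p @ extend f P \<noteq> extend f Z" if "prefix P L'" "prefix Z y" for P Z
      proof
        assume "p @ extend f P = extend f Z"
        moreover have "prefix P x" using that(1) xe \<open>L = L' @ [a]\<close> by (auto simp: prefix_def)
        ultimately have "?i \<le> length P" using inI[of P Z] that(2) between by blast
        moreover have "length P < length L" using that(1) \<open>L = L' @ [a]\<close> by (auto dest: prefix_length_le)
        ultimately show False using len by simp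
      qed
      then show ?thesis using eq xe that by (auto simp: desync_def)
    qed
    show "desync f R' y (p @ extend f (L @ M @ [a])) s" if "R = a # R'" for R' a
    proof -
      have "(p @ extend f (L @ M @ [a])) @ extend f P \<noteq> extend f Z" if "prefix P R'" "prefix Z y" for P Z
      proof
        assume "(p @ extend f (L @ M @ [a])) @ extend f P = extend f Z"
        then have "p @ extend f (L @ M @ a # P) = extend f Z" by simp
        moreover have "prefix (L @ M @ a # P) x" using that(1) xe \<open>R = a # R'\<close> by simp
        ultimately have "length (L @ M @ a # P) \<le> ?j" using inI[of _ Z] that(2) between by blast
        then show False using len by simp
      qed
      then show ?thesis using eq xe that by (auto simp: desync_def)
    qed
  qed
qed

text \<open>
  Enlarging the covering word and shrinking the covered one creates no common cuts: the new cuts of the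
  covering word lie outside the old covered region, since nonempty letter images keep cuts apart.
\<close>

lemma desync_extend:
  assumes ne: "\<And>a. f a \<noteq> []" and d: "desync f (\<alpha> @ x @ \<beta>) y p s"
  shows "desync f x (c @ y @ e) (extend f c @ p @ extend f \<alpha>) (extend f \<beta> @ s @ extend f e)"
proof -
  have eq: "extend f y = p @ extend f (\<alpha> @ x @ \<beta>) @ s" using d by (simp add: desync_def)
  have "(extend f c @ p @ extend f \<alpha>) @ extend f P \<noteq> extend f Q"
    if P: "prefix P x" and Q: "prefix Q (c @ y @ e)" for P Q
  proof
    assume cut: "(extend f c @ p @ extend f \<alpha>) @ extend f P = extend f Q"
    have "prefix c Q"
    proof (cases "prefix c Q")
      case False
      then have "prefix Q c" using Q prefix_same_cases[of Q "c @ y @ e" c] by auto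
      then have "Q = c" by (rule extend_prefix_eq[of _ _ f]) (use ne in \<open>simp_all add: cut[symmetric]\<close>)
      then show ?thesis by simp
    qed
    then obtain Q' where Q': "Q = c @ Q'" by (auto simp: prefix_def)
    have cut': "p @ extend f (\<alpha> @ P) = extend f Q'" using cut Q' by simp
    have aP: "prefix (\<alpha> @ P) (\<alpha> @ x @ \<beta>)" using P by (auto simp: prefix_def)
    have "prefix Q' y"
    proof (cases "prefix Q' y")
      case False
      then have "prefix y Q'" using Q Q' prefix_same_cases[of Q' "y @ e" y] by auto
      moreover have "length (extend f Q') \<le> length (extend f y)"
        unfolding cut'[symmetric] eq using prefix_length_le[OF prefix_extend[OF aP, of f]] by simp
      ultimately have "y = Q'" using ne by (intro extend_prefix_eq[of _ _ f]) auto
      then show ?thesis by simp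
    qed
    then show False using d aP cut' unfolding desync_def by blast
  qed
  then show ?thesis using eq by (auto simp: desync_def)
qed

section \<open>The language of a substitution and its bounded letters\<close>

lemma ex_length_bound:
  assumes "finite A"
  obtains m where "0 < m" "\<And>a. a \<in> A \<Longrightarrow> length (f a) \<le> m"
proof
  show "0 < Suc (Max (insert 0 ((\<lambda>a. length (f a)) ` A)))" by simp
  show "length (f a) \<le> Suc (Max (insert 0 ((\<lambda>a. length (f a)) ` A)))" if "a \<in> A" for a
    using that assms by (intro le_SucI Max_ge) auto
qed

text \<open>
  The properties of the factors of an injective D0L system that matter. The letter images are nonempty
  also outside of the alphabet, so that lengths never decrease, whatever the word. The last condition holds because
  a factor longer than the axiom comes from an image.
\<close>

locale substitution_language =
  fixes A :: "'a set" and F :: "'a \<Rightarrow> 'a list" and S :: "'a list set"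
  assumes finite_alphabet: "finite A"
    and nonerasing: "F a \<noteq> []"
    and letter_image: "a \<in> A \<Longrightarrow> F a \<in> lists A"
    and words: "S \<subseteq> lists A"
    and factor_closed: "v \<in> S \<Longrightarrow> sublist u v \<Longrightarrow> u \<in> S"
    and image_closed: "u \<in> S \<Longrightarrow> extend F u \<in> S"
    and letters: "a \<in> A \<Longrightarrow> [a] \<in> S"
    and injective: "u \<in> S \<Longrightarrow> v \<in> S \<Longrightarrow> extend F u = extend F v \<Longrightarrow> u = v"
    and ancestors: "\<exists>N. \<forall>u \<in> S. N < length u \<longrightarrow> (\<exists>v \<in> S. sublist u (extend F v))"
begin

definition iter :: "nat \<Rightarrow> 'a \<Rightarrow> 'a list" where
  "iter n a = (extend F ^^ n) [a]"

lemma iter_append: "(extend F ^^ n) (u @ v) = (extend F ^^ n) u @ (extend F ^^ n) v"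
  by (induction n) auto

lemma iter_Nil: "(extend F ^^ n) [] = []"
  by (induction n) auto

lemma iter_extend: "(extend F ^^ n) w = extend (iter n) w"
proof (induction w)
  case (Cons a w)
  then show ?case using iter_append[of n "[a]" w] by (simp add: iter_def)
qed (simp add: iter_Nil)

lemma length_image: "length w \<le> length (extend F w)"
  by (rule length_extend_ge) (simp add: nonerasing)

lemma length_iter: "length w \<le> length ((extend F ^^ n) w)"
proof (induction n)
  case (Suc n)
  then show ?case using length_image[of "(extend F ^^ n) w"] by simp
qed simp

lemma length_iter_mono: "i \<le> j \<Longrightarrow> length ((extend F ^^ i) w) \<le> length ((extend F ^^ j) w)"
  using length_iter[of "(extend F ^^ i) w" "j - i"]
  by (metis comp_apply funpow_add le_add_diff_inverse2)

lemma image_in_lists: "w \<in> lists A \<Longrightarrow> extend F w \<in> lists A"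
  by (rule extend_in_lists) (auto dest: letter_image)

lemma iter_in_lists: "w \<in> lists A \<Longrightarrow> (extend F ^^ n) w \<in> lists A"
  by (induction n) (simp_all only: funpow.simps comp_apply id_apply image_in_lists)

lemma iter_in_S: "w \<in> S \<Longrightarrow> (extend F ^^ n) w \<in> S"
  by (induction n) (auto dest: image_closed)

lemma iter_injective: "u \<in> S \<Longrightarrow> v \<in> S \<Longrightarrow> (extend F ^^ n) u = (extend F ^^ n) v \<Longrightarrow> u = v"
  by (induction n) (auto dest: injective iter_in_S)

lemma iter_ancestors: "\<exists>N. \<forall>u \<in> S. N < length u \<longrightarrow> (\<exists>v \<in> S. sublist u ((extend F ^^ k) v))"
proof (induction k)
  case 0
  then show ?case by auto
next
  case (Suc k)
  then obtain N where N: "\<And>u. u \<in> S \<Longrightarrow> N < length u \<Longrightarrow> \<exists>v \<in> S. sublist u ((extend F ^^ k) v)" by blast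
  obtain N1 where N1: "\<And>u. u \<in> S \<Longrightarrow> N1 < length u \<Longrightarrow> \<exists>v \<in> S. sublist u (extend F v)"
    using ancestors by blast
  obtain m where m: "0 < m" "\<And>a. a \<in> A \<Longrightarrow> length (F a) \<le> m"
    using ex_length_bound[OF finite_alphabet] by blast
  have "\<exists>v \<in> S. sublist u ((extend F ^^ Suc k) v)" if u: "u \<in> S" "max N1 (m * N) < length u" for u
  proof -
    obtain v where v: "v \<in> S" "sublist u (extend F v)" using N1 u by auto
    have "length (extend F v) \<le> m * length v" using v(1) words m(2) by (intro length_extend_le) auto
    then have "m * N < m * length v" using sublist_length_le[OF v(2)] u(2) by linarith
    then have "N < length v" by simp
    then obtain v' where "v' \<in> S" "sublist v ((extend F ^^ k) v')" using N v by auto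
    then show ?thesis using v(2) sublist_extend[of v _ F] sublist_order.order.trans by (intro bexI[of _ v']) auto
  qed
  then show ?case by blast
qed

text \<open>
  Over a finite alphabet, the iterates of a letter form a finite set if and only if their lengths are
  bounded.
\<close>

definition bounded :: "'a \<Rightarrow> bool" where
  "bounded a \<longleftrightarrow> (\<exists>L. \<forall>n. length (iter n a) \<le> L)"

text \<open>
  The finite orbit of a bounded letter is purely periodic by injectivity. Lengths along an orbit do not
  decrease, so on a periodic orbit they are constant.
\<close>

lemma bounded_letter_length:
  assumes a: "a \<in> A" "bounded a"
  shows "length (iter n a) = 1"
proof -
  obtain L where L: "\<And>n. length (iter n a) \<le> L" using a(2) unfolding bounded_def by blast
  have "range (\<lambda>n. iter n a) \<subseteq> {w. w \<in> lists A \<and> length w \<le> L}"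
    using L a(1) iter_in_lists[of "[a]"] by (auto simp: iter_def)
  then have "finite (range (\<lambda>n. iter n a))"
    using finite_words_upto[OF finite_alphabet] finite_subset by blast
  then obtain i j where ij: "i \<noteq> j" "iter i a = iter j a"
    using finite_imageD[of "\<lambda>n. iter n a" UNIV] by (auto simp: inj_on_def)
  obtain i d where d: "0 < d" "iter (i + d) a = iter i a"
  proof (cases "i < j")
    case True
    then show ?thesis using ij that[of "j - i" i] by simp
  next
    case False
    then show ?thesis using ij that[of "i - j" j] by simp
  qed
  have "(extend F ^^ i) ((extend F ^^ d) [a]) = (extend F ^^ i) [a]"
    using d(2) by (simp add: iter_def funpow_add)
  then have fix_d: "(extend F ^^ d) [a] = [a]"
    using iter_injective[OF _ letters[OF a(1)]] iter_in_S[OF letters[OF a(1)]] by blast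
  have "(extend F ^^ (d * k)) [a] = [a]" for k
    by (induction k) (simp_all add: funpow_add fix_d)
  moreover have "n \<le> d * n" using d(1) by simp
  ultimately have "length (iter n a) \<le> 1"
    using length_iter_mono[of n "d * n" "[a]"] by (simp add: iter_def)
  then show ?thesis using length_iter[of "[a]" n] by (simp add: iter_def)
qed

lemma bounded_word_length:
  assumes "w \<in> lists A" "\<forall>a \<in> set w. bounded a"
  shows "length ((extend F ^^ n) w) = length w"
  using assms by (induction w) (simp_all add: iter_extend bounded_letter_length)

text \<open>
  By the previous lemma, the iterates of \<open>F a\<close> all have the length of \<open>F a\<close>.
\<close>

lemma bounded_if_image_bounded:
  assumes "a \<in> A" "\<forall>b \<in> set (F a). bounded b"
  shows "bounded a"
proof -
  have "length (iter n a) \<le> length (F a)" for n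
  proof -
    have "length (iter n a) \<le> length (iter (Suc n) a)"
      unfolding iter_def by (rule length_iter_mono) simp
    also have "iter (Suc n) a = (extend F ^^ n) (F a)" by (simp add: iter_def funpow_swap1)
    also have "length \<dots> = length (F a)"
      using assms letter_image by (intro bounded_word_length) auto
    finally show ?thesis .
  qed
  then show ?thesis unfolding bounded_def by blast
qed

text \<open>
  Suppose that a long factor of \<open>F(x)\<close> has only bounded letters. Letters of \<open>x\<close> whose image lies inside are
  bounded, so their images have length one and every position there is a cut of \<open>x\<close>. Among \<open>m\<close>
  consecutive positions there is a cut of \<open>y\<close>, as letter images have length at most \<open>m\<close>; it is a common cut.
\<close>

lemma desync_factor_unbounded:
  assumes m: "0 < m" "\<And>a. a \<in> A \<Longrightarrow> length (F a) \<le> m"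
    and x: "x \<in> lists A" and y: "y \<in> lists A" and d: "desync F x y p s"
    and z: "sublist z (extend F x)" "m * (m + 2) \<le> length z"
  shows "\<exists>a \<in> set z. \<not> bounded a"
proof (rule ccontr)
  assume "\<not> ?thesis"
  then have bz: "\<forall>a \<in> set z. bounded a" by blast
  obtain L R where LR: "extend F x = L @ z @ R" using z(1) by (auto simp: sublist_def)
  have mz: "m \<le> length z" using z(2) by (rule le_trans[rotated]) simp
  obtain X1 X2 X3 M1 M2 where t: "x = X1 @ X2 @ X3" "z = M1 @ extend F X2 @ M2"
    "extend F X1 = L @ M1" "extend F X3 = M2 @ R" "length z \<le> m * (length X2 + 2)"
    using extend_trim[OF LR _ mz] m(2) x by (metis in_listsD)
  have "m * (m + 2) \<le> m * (length X2 + 2)" by (rule le_trans[OF z(2) t(5)])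
  then have mX: "m \<le> length X2" using m(1) by simp
  have unit: "length (F a) = 1" if "a \<in> set X2" for a
  proof -
    have aA: "a \<in> A" using that t(1) x by auto
    have "set (F a) \<subseteq> set (extend F X2)" using that by (auto simp: extend_def)
    then have "\<forall>b \<in> set (F a). bounded b" using bz t(2) by auto
    then have "bounded a" by (rule bounded_if_image_bounded[OF aA])
    then show ?thesis using bounded_letter_length[OF aA, of 1] by (simp add: iter_def)
  qed
  have len: "length (extend F w) = length w" if "set w \<subseteq> set X2" for w
    using that unit by (induction w) auto
  let ?p = "p @ extend F X1"
  have d2: "desync F X2 y ?p (extend F X3 @ s)"
    using d unfolding t(1) by (rule desync_sublist)
  then have "extend F y = ?p @ (extend F X2 @ extend F X3 @ s)" by (simp add: desync_def)
  then obtain Y1 Y2 C where Y: "y = Y1 @ Y2" "extend F Y1 = ?p @ C"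
    "extend F X2 @ extend F X3 @ s = C @ extend F Y2" "length C \<le> m"
    using extend_split_left[of F y ?p _ m] m(2) y by auto
  let ?P = "take (length C) X2"
  have "length (extend F ?P) = length C"
    using len[of ?P] mX Y(4) by (auto dest: in_set_takeD)
  moreover have "extend F X2 = extend F ?P @ extend F (drop (length C) X2)"
    by (metis append_take_drop_id extend_simps(3))
  ultimately have "extend F ?P = C" using Y(3) by (metis append.assoc append_eq_append_conv)
  then have "?p @ extend F ?P = extend F Y1" using Y(2) by simp
  moreover have "prefix ?P X2" "prefix Y1 y" using Y(1) take_is_prefix by auto
  ultimately show False using d2 unfolding desync_def by blast
qed

end

section \<open>Iterates of the substitution through few words\<close>

lemma star_trans:
  assumes "B \<subseteq> concat ` lists E" "w \<in> concat ` lists B"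
  shows "w \<in> concat ` lists E"
proof -
  have "l \<in> lists B \<Longrightarrow> concat l \<in> concat ` lists E" for l
  proof (induction l)
    case Nil
    show ?case by (intro image_eqI[of _ _ "[]"]) auto
  next
    case (Cons b l)
    then obtain l' where l': "l' \<in> lists E" "concat l = concat l'" by auto
    obtain e where e: "e \<in> lists E" "b = concat e" using assms(1) Cons.prems by auto
    show ?case by (intro image_eqI[of _ _ "e @ l'"]) (use l' e in auto)
  qed
  then show ?thesis using assms(2) by blast
qed

lemma star_restrict:
  assumes "w \<in> concat ` lists E" "w \<in> lists A"
  shows "w \<in> concat ` lists (E \<inter> lists A)"
proof -
  obtain l where l: "l \<in> lists E" "w = concat l" using assms(1) by auto
  then have "l \<in> lists (E \<inter> lists A)" using assms(2) by auto
  then show ?thesis using l(2) by blast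
qed

text \<open>
  Removing the empty word from a set of factors does not change its products.
\<close>

lemma star_remove_Nil:
  assumes "w \<in> concat ` lists E"
  shows "w \<in> concat ` lists (E - {[]})"
proof -
  obtain l where l: "l \<in> lists E" "w = concat l" using assms by auto
  then have "filter (\<lambda>u. u \<noteq> []) l \<in> lists (E - {[]})" by auto
  moreover have "concat (filter (\<lambda>u. u \<noteq> []) l) = concat l" by (induction l) auto
  ultimately show ?thesis using l(2) by (intro image_eqI[of _ _ "filter (\<lambda>u. u \<noteq> []) l"]) auto
qed

lemma extend_id: "extend (\<lambda>b. b) = concat"
  by (rule HOL.ext) (simp add: extend_def)

lemma concat_word_power: "concat (word_power t k) = word_power (concat t) k"
  by (induction k) auto

context substitution_language
begin

text \<open>
  The minimum is over all exponents at once. This makes the factorization stable: no further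
  iteration of the substitution can be written with fewer words.
\<close>

lemma minimal_factorization:
  obtains n B g where "0 < n" "finite B" "B \<subseteq> lists A" "[] \<notin> B"
    "\<And>a. a \<in> A \<Longrightarrow> g a \<in> lists B \<and> concat (g a) = iter n a"
    "\<And>n' E. 0 < n' \<Longrightarrow> finite E \<Longrightarrow> card E < card B \<Longrightarrow>
       \<not> (\<forall>a \<in> A. iter n' a \<in> concat ` lists E)"
proof -
  define ok where "ok = (\<lambda>(n :: nat, B :: 'a list set). 0 < n \<and> finite B \<and>
    (\<forall>a \<in> A. iter n a \<in> concat ` lists B))"
  have "ok (1, iter 1 ` A)"
  proof -
    have "iter 1 a \<in> concat ` lists (iter 1 ` A)" if "a \<in> A" for a
      by (intro image_eqI[of _ _ "[iter 1 a]"]) (use that in auto)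
    then show ?thesis using finite_alphabet by (simp add: ok_def)
  qed
  then obtain H where "ok H" "\<And>H'. ok H' \<Longrightarrow> card (snd H) \<le> card (snd H')"
    using ex_has_least_nat[of ok _ "\<lambda>H. card (snd H)"] by blast
  then obtain n B0 where B0: "ok (n, B0)" and least: "\<And>n' E. ok (n', E) \<Longrightarrow> card B0 \<le> card E"
    by (metis prod.collapse snd_conv)
  let ?B = "(B0 - {[]}) \<inter> lists A"
  have itA: "iter k a \<in> lists A" if "a \<in> A" for k a
    unfolding iter_def by (rule iter_in_lists) (use that in auto)
  have "\<forall>a \<in> A. \<exists>l. l \<in> lists ?B \<and> concat l = iter n a"
  proof
    fix a assume a: "a \<in> A"
    then have "iter n a \<in> concat ` lists ?B"
      using B0 itA by (intro star_restrict star_remove_Nil) (auto simp: ok_def)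
    then obtain l where "iter n a = concat l" "l \<in> lists ?B" by (rule imageE)
    then show "\<exists>l. l \<in> lists ?B \<and> concat l = iter n a" by metis
  qed
  then obtain g where g: "\<forall>a \<in> A. g a \<in> lists ?B \<and> concat (g a) = iter n a"
    by (rule bchoice[THEN exE])
  have cardB: "card ?B \<le> card B0" using B0 by (intro card_mono) (auto simp: ok_def)
  show thesis
  proof (rule that[of n ?B g])
    show "0 < n" "finite ?B" using B0 by (auto simp: ok_def)
    show "\<not> (\<forall>a \<in> A. iter n' a \<in> concat ` lists E)" if "0 < n'" "finite E" "card E < card ?B" for n' E
      using least[of n' E] that cardB by (auto simp: ok_def)
  qed (use g in auto)
qed

text \<open>
  Long factors have ancestors of every order, so a long covering contains the lift of a long covering
  at the level of \<open>k\<close>-th ancestors: the covered word is trimmed to full images, the covering word is completed to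
  one.
\<close>

lemma desync_descends:
  assumes N: "\<forall>u \<in> S. N < length u \<longrightarrow> (\<exists>v \<in> S. sublist u ((extend F ^^ k) v))"
    and mF: "\<And>a. a \<in> A \<Longrightarrow> length (F a) \<le> mF" and mk: "\<And>a. a \<in> A \<Longrightarrow> length (iter k a) \<le> mk"
    and xy: "x \<in> S" "y \<in> S" "desync F x y p s"
    and long: "N < length x" "mF * N < length x" "mk * (M + 2) < length x"
  obtains x' y' p' s' where "x' \<in> S" "y' \<in> S" "M \<le> length x'"
    "desync F ((extend F ^^ k) x') ((extend F ^^ k) y') p' s'" "sublist ((extend F ^^ k) x') x"
proof -
  obtain v where v: "v \<in> S" "sublist x ((extend F ^^ k) v)" using N xy(1) long(1) by blast
  obtain L R where LR: "extend (iter k) v = L @ x @ R" using v(2) by (auto simp: sublist_def iter_extend)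
  have vA: "v \<in> lists A" and yA: "y \<in> lists A" using v xy words by auto
  have "mk * 1 \<le> mk * (M + 2)" by (rule mult_le_mono2) simp
  then have mkx: "mk \<le> length x" using long(3) by simp
  obtain X1 X2 X3 M1 M2 where t: "v = X1 @ X2 @ X3" "x = M1 @ extend (iter k) X2 @ M2"
    "length x \<le> mk * (length X2 + 2)"
    using extend_trim[OF LR _ mkx] mk vA by (metis in_listsD)
  have "mk * (M + 2) < mk * (length X2 + 2)" by (rule less_le_trans[OF long(3) t(3)])
  then have MX: "M \<le> length X2" by simp
  have "length x \<le> length (extend F x)" by (rule length_image)
  also have "\<dots> \<le> length (extend F y)" using xy(3) by (simp add: desync_def)
  also have "\<dots> \<le> mF * length y" using yA mF by (intro length_extend_le) auto
  finally have "mF * N < mF * length y" using long(2) by linarith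
  then have "N < length y" by simp
  then obtain y' where y': "y' \<in> S" "sublist y ((extend F ^^ k) y')" using N xy(2) by blast
  obtain c e where ce: "(extend F ^^ k) y' = c @ y @ e" using y'(2) by (auto simp: sublist_def)
  have "desync F ((extend F ^^ k) X2) ((extend F ^^ k) y') (extend F c @ p @ extend F M1) (extend F M2 @ s @ extend F e)"
    unfolding ce using xy(3) t(2) by (intro desync_extend) (auto simp: nonerasing iter_extend)
  moreover have "X2 \<in> S" using factor_closed[OF v(1)] t(1) by auto
  moreover have "sublist ((extend F ^^ k) X2) x" using t(2) by (auto simp: iter_extend)
  ultimately show thesis using that y'(1) MX by blast
qed

text \<open>
  The minimal factorization \<open>F\<^sup>n = concat \<circ> g\<close> yields two elementary morphisms on \<open>B\<close>: concatenation and
  \<open>\<psi> = g \<circ> concat\<close>. Any set of fewer words through which one of them factors would serve for \<open>F\<^sup>n\<close> or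
  \<open>F\<^bsup>2n\<^esup>\<close>, respectively. A common cut of \<open>concat \<circ> \<psi>\<close> is also a cut of \<open>F\<close> at the level of \<open>F\<^bsup>2n-1\<^esup>\<close>, so there is none. Hence
  either concatenation has a long stretch without common cut, or the two words over \<open>B\<close> agree on a long stretch,
  in which \<open>\<psi>\<close> has no common cut. The defect theorem gives a power in both cases.
\<close>

lemma desync_imp_powers:
  obtains K where "\<And>q. 0 < q \<Longrightarrow> \<exists>N. \<forall>x \<in> S. \<forall>y \<in> S. \<forall>p s. desync F x y p s \<longrightarrow> N \<le> length x \<longrightarrow>
    (\<exists>z. z \<noteq> [] \<and> length z \<le> K \<and> sublist (word_power z q) (extend F x))"
proof -
  obtain n B g where n: "0 < n" and finB: "finite B" and BA: "B \<subseteq> lists A" and neB: "[] \<notin> B"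
    and g: "\<And>a. a \<in> A \<Longrightarrow> g a \<in> lists B \<and> concat (g a) = iter n a"
    and minimal: "\<And>n' E. 0 < n' \<Longrightarrow> finite E \<Longrightarrow> card E < card B \<Longrightarrow>
       \<not> (\<forall>a \<in> A. iter n' a \<in> concat ` lists E)"
    using minimal_factorization by blast
  define \<psi> where "\<psi> = extend g"
  have g_extend: "extend g w \<in> lists B \<and> concat (extend g w) = (extend F ^^ n) w" if "w \<in> lists A" for w
    using that g by (induction w) (auto simp: iter_extend)
  have \<psi>: "\<psi> b \<in> lists B \<and> concat (\<psi> b) = (extend F ^^ n) b" if "b \<in> B" for b
    using g_extend that BA unfolding \<psi>_def by auto
  have \<psi>_extend: "extend \<psi> w \<in> lists B \<and> concat (extend \<psi> w) = (extend F ^^ n) (concat w)" if "w \<in> lists B" for w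
    using that \<psi> by (induction w) (auto simp: iter_append iter_Nil)
  have neid: "b \<noteq> []" if "b \<in> B" for b using that neB by auto
  have ne\<psi>: "\<psi> b \<noteq> []" if "b \<in> B" for b
    using \<psi>[OF that] neid[OF that] length_iter[of b n] by auto
  have el_id: "elementary_on B (\<lambda>b. b)"
    unfolding elementary_on_def
  proof (intro allI impI notI)
    fix E assume E: "finite E \<and> card E < card B" "(\<lambda>b. b) ` B \<subseteq> concat ` lists E"
    have "iter n a \<in> concat ` lists E" if "a \<in> A" for a
    proof (rule star_trans)
      show "B \<subseteq> concat ` lists E" using E by simp
      show "iter n a \<in> concat ` lists B" by (intro image_eqI[of _ _ "g a"]) (use g[OF that] in auto)
    qed
    then show False using minimal[OF n] E by blast
  qed
  have el_\<psi>: "elementary_on B \<psi>"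
    unfolding elementary_on_def
  proof (intro allI impI notI)
    fix E assume E: "finite E \<and> card E < card B" "\<psi> ` B \<subseteq> concat ` lists E"
    have "iter (n + n) a \<in> concat ` lists (concat ` E)" if a: "a \<in> A" for a
    proof (rule star_trans)
      show "(\<lambda>b. (extend F ^^ n) b) ` B \<subseteq> concat ` lists (concat ` E)"
      proof
        fix w assume "w \<in> (\<lambda>b. (extend F ^^ n) b) ` B"
        then obtain b where b: "b \<in> B" "w = concat (\<psi> b)" using \<psi> by auto
        then obtain l where l: "l \<in> lists E" "\<psi> b = concat l" using E(2) by blast
        have "concat (concat l) = concat (map concat l)" by (induction l) auto
        moreover have "map concat l \<in> lists (concat ` E)" using l(1) by auto
        ultimately show "w \<in> concat ` lists (concat ` E)" using b l by (intro image_eqI[of _ _ "map concat l"]) auto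
      qed
      have "iter (n + n) a = (extend F ^^ n) (concat (g a))"
        using g[OF a] by (simp add: iter_def funpow_add)
      also have "\<dots> = concat (map (extend F ^^ n) (g a))"
        by (simp add: iter_extend[abs_def] extend_concat)
      finally show "iter (n + n) a \<in> concat ` lists ((\<lambda>b. (extend F ^^ n) b) ` B)"
        using g[OF a] by (intro image_eqI[of _ _ "map (extend F ^^ n) (g a)"]) auto
    qed
    moreover have "card (concat ` E) < card B" using E(1) card_image_le[of E concat] by auto
    moreover have "0 < n + n" using n by simp
    ultimately show False using minimal[of "n + n" "concat ` E"] E(1) by blast
  qed
  obtain K1 where K1: "\<And>q. \<exists>N. \<forall>x y p s. x \<in> lists B \<longrightarrow> y \<in> lists B \<longrightarrow> desync (\<lambda>b. b) x y p s \<longrightarrow>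
    N \<le> length x \<longrightarrow> (\<exists>t. t \<noteq> [] \<and> length t \<le> K1 \<and> sublist (word_power t q) x)"
    using elementary_desync_powers[OF finB el_id neid] by blast
  obtain K2 where K2: "\<And>q. \<exists>N. \<forall>x y p s. x \<in> lists B \<longrightarrow> y \<in> lists B \<longrightarrow> desync \<psi> x y p s \<longrightarrow>
    N \<le> length x \<longrightarrow> (\<exists>t. t \<noteq> [] \<and> length t \<le> K2 \<and> sublist (word_power t q) x)"
    using elementary_desync_powers[OF finB el_\<psi> ne\<psi>] by blast
  have inj_id: "inj_on (extend (\<lambda>b. b)) (lists B)" by (rule elementary_imp_inj_extend[OF finB el_id neid])
  obtain mB where mB: "0 < mB" "\<And>b. b \<in> B \<Longrightarrow> length b \<le> mB"
    using ex_length_bound[OF finB, of "\<lambda>b. b"] by blast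
  obtain m\<psi> where m\<psi>: "0 < m\<psi>" "\<And>b. b \<in> B \<Longrightarrow> length (\<psi> b) \<le> m\<psi>"
    using ex_length_bound[OF finB, of \<psi>] by blast
  obtain mF where mF: "0 < mF" "\<And>a. a \<in> A \<Longrightarrow> length (F a) \<le> mF"
    using ex_length_bound[OF finite_alphabet, of F] by blast
  \<comment> \<open>The covering is lifted so that one more application of the substitution gives the iterate of order 2n.\<close>
  define k where "k = n + (n - 1)"
  have Suc_k: "Suc k = n + n" using n by (simp add: k_def)
  obtain mk where mk: "0 < mk" "\<And>a. a \<in> A \<Longrightarrow> length (iter k a) \<le> mk"
    using ex_length_bound[OF finite_alphabet, of "iter k"] by blast
  obtain Nk where Nk: "\<forall>u \<in> S. Nk < length u \<longrightarrow> (\<exists>v \<in> S. sublist u ((extend F ^^ k) v))"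
    using iter_ancestors[of k] by blast
  define K where "K = mB * K1 + mB * (m\<psi> * K2)"
  have "\<exists>N. \<forall>x \<in> S. \<forall>y \<in> S. \<forall>p s. desync F x y p s \<longrightarrow> N \<le> length x \<longrightarrow>
    (\<exists>z. z \<noteq> [] \<and> length z \<le> K \<and> sublist (word_power z q) (extend F x))" if q: "0 < q" for q
  proof -
    obtain N1 where N1: "\<And>x y p s. x \<in> lists B \<Longrightarrow> y \<in> lists B \<Longrightarrow> desync (\<lambda>b. b) x y p s \<Longrightarrow>
      N1 \<le> length x \<Longrightarrow> \<exists>t. t \<noteq> [] \<and> length t \<le> K1 \<and> sublist (word_power t q) x"
      using K1[of q] by blast
    obtain N2 where N2: "\<And>x y p s. x \<in> lists B \<Longrightarrow> y \<in> lists B \<Longrightarrow> desync \<psi> x y p s \<Longrightarrow>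
      N2 \<le> length x \<Longrightarrow> \<exists>t. t \<noteq> [] \<and> length t \<le> K2 \<and> sublist (word_power t q) x"
      using K2[of q] by blast
    \<comment> \<open>A word of length M in three pieces has an outer piece of length N1 + 1 or a middle piece which contains
      the image under \<psi> of a word of length N2.\<close>
    define M where "M = 2 * (N1 + 1) + m\<psi> * (N2 + 2)"
    define N where "N = Suc (Nk + mF * Nk + mk * (M + 2))"
    have "\<exists>z. z \<noteq> [] \<and> length z \<le> K \<and> sublist (word_power z q) (extend F x)"
      if xy: "x \<in> S" "y \<in> S" "desync F x y p s" and long: "N \<le> length x" for x y p s
    proof -
      obtain x2 y2 p2 s2 where d2: "x2 \<in> S" "y2 \<in> S" "M \<le> length x2"
        "desync F ((extend F ^^ k) x2) ((extend F ^^ k) y2) p2 s2" "sublist ((extend F ^^ k) x2) x"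
        by (rule desync_descends[OF Nk mF(2) mk(2) xy, of M]) (use long in \<open>auto simp: N_def\<close>)
      have A2: "x2 \<in> lists A" "y2 \<in> lists A" using d2 words by auto
      let ?X = "extend g x2" and ?Y = "extend g y2"
      have XB: "?X \<in> lists B" "?Y \<in> lists B" using g_extend A2 by auto
      have concat_\<psi>: "concat (extend \<psi> (extend g w)) = extend F ((extend F ^^ k) w)" if "w \<in> lists A" for w
      proof -
        have "concat (extend \<psi> (extend g w)) = (extend F ^^ (n + n)) w"
          using g_extend[OF that] \<psi>_extend[of "extend g w"] by (simp add: funpow_add)
        then show ?thesis by (simp flip: Suc_k)
      qed
      have "sublist (extend F ((extend F ^^ k) x2)) (extend F x)" using d2(5) by (rule sublist_extend)
      then have in_x: "sublist (concat (extend \<psi> ?X)) (extend F x)" by (simp add: concat_\<psi> A2)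
      have no_cut: "p2 @ concat (extend \<psi> P) \<noteq> concat (extend \<psi> Q)" if "prefix P ?X" "prefix Q ?Y" for P Q
      proof
        have split: "concat (extend \<psi> P) = extend F ((extend F ^^ (n - 1)) (concat P)) \<and>
          prefix ((extend F ^^ (n - 1)) (concat P)) ((extend F ^^ k) w)"
          if P: "prefix P (extend g w)" and w: "w \<in> lists A" for P w
        proof -
          obtain R where R: "extend g w = P @ R" using P by (auto simp: prefix_def)
          then have "P \<in> lists B" using g_extend[OF w] by auto
          then have "concat (extend \<psi> P) = (extend F ^^ Suc (n - 1)) (concat P)" using \<psi>_extend n by simp
          moreover have "prefix (concat P) ((extend F ^^ n) w)" using g_extend[OF w] R by (metis concat_append prefixI)
          then have "prefix ((extend F ^^ (n - 1)) (concat P)) ((extend F ^^ (n - 1)) ((extend F ^^ n) w))"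
            unfolding iter_extend[of "n - 1"] by (rule prefix_extend)
          then have "prefix ((extend F ^^ (n - 1)) (concat P)) ((extend F ^^ k) w)"
            unfolding k_def add.commute[of n] by (simp add: funpow_add)
          ultimately show ?thesis by simp
        qed
        assume "p2 @ concat (extend \<psi> P) = concat (extend \<psi> Q)"
        then show False
          using split[OF that(1) A2(1)] split[OF that(2) A2(2)] d2(4) unfolding desync_def by metis
      qed
      have eq: "extend (\<lambda>b. b) (extend \<psi> ?Y) = p2 @ extend (\<lambda>b. b) (extend \<psi> ?X) @ s2"
        using d2(4) A2 by (simp add: extend_id concat_\<psi> desync_def)
      have \<psi>B: "extend \<psi> ?X \<in> lists B" "extend \<psi> ?Y \<in> lists B" using \<psi>_extend XB by auto
      have lenX: "M \<le> length (extend \<psi> ?X)"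
      proof -
        have "length x2 \<le> length ?X"
        proof (rule length_extend_ge)
          fix a assume "a \<in> set x2"
          then have "a \<in> A" using A2 by auto
          then show "g a \<noteq> []" using g[of a] length_iter[of "[a]" n] by (auto simp: iter_def)
        qed
        also have "length ?X \<le> length (extend \<psi> ?X)" using ne\<psi> XB by (intro length_extend_ge) auto
        finally show ?thesis using d2(3) by simp
      qed
      \<comment> \<open>A long stretch over B without common cut for concatenation.\<close>
      have id_case: ?thesis
        if d: "desync (\<lambda>b. b) X' (extend \<psi> ?Y) p' s'" "sublist X' (extend \<psi> ?X)" "N1 \<le> length X'" for X' p' s'
      proof -
        have X'B: "X' \<in> lists B" using d(2) \<psi>B(1) set_mono_sublist by fastforce
        obtain t where t: "t \<noteq> []" "length t \<le> K1" "sublist (word_power t q) X'"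
          using N1[OF X'B \<psi>B(2) d(1) d(3)] by blast
        have "set t \<subseteq> set (word_power t q)" using q by (cases q) auto
        then have tB: "t \<in> lists B" using set_mono_sublist[OF t(3)] X'B by auto
        then have "length (extend (\<lambda>b. b) t) \<le> mB * length t" using mB by (intro length_extend_le) auto
        also have "\<dots> \<le> mB * K1" using t(2) by simp
        finally have "length (concat t) \<le> K" by (simp add: extend_id K_def)
        moreover have "concat t \<noteq> []" using t(1) tB neB by (cases t) auto
        moreover have "sublist (word_power (concat t) q) (concat (extend \<psi> ?X))"
          using sublist_extend[OF sublist_order.order.trans[OF t(3) d(2)], of "\<lambda>b. b"]
          by (simp add: extend_word_power extend_id concat_word_power)
        ultimately show ?thesis using in_x sublist_order.order.trans by blast
      qed
      show ?thesis
      proof (rule common_cut_or_desync[OF inj_id neid \<psi>B eq])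
        assume "desync (\<lambda>b. b) (extend \<psi> ?X) (extend \<psi> ?Y) p2 s2"
        then show ?thesis by (rule id_case) (use lenX in \<open>auto simp: M_def\<close>)
      next
        fix L M' R Y1 Y2
        assume common: "extend \<psi> ?X = L @ M' @ R" "extend \<psi> ?Y = Y1 @ M' @ Y2"
          "extend (\<lambda>b. b) Y1 = p2 @ extend (\<lambda>b. b) L"
          "\<And>L' a. L = L' @ [a] \<Longrightarrow> desync (\<lambda>b. b) L' (extend \<psi> ?Y) p2 (a @ extend (\<lambda>b. b) (M' @ R) @ s2)"
          "\<And>R' a. R = a # R' \<Longrightarrow> desync (\<lambda>b. b) R' (extend \<psi> ?Y) (p2 @ extend (\<lambda>b. b) (L @ M' @ [a])) s2"
        have "N1 + 1 \<le> length L \<or> N1 + 1 \<le> length R \<or> m\<psi> * (N2 + 2) \<le> length M'"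
          using lenX common(1) by (auto simp: M_def)
        then consider "N1 + 1 \<le> length L" | "N1 + 1 \<le> length R" | "m\<psi> * (N2 + 2) \<le> length M'" by blast
        then show ?thesis
        proof cases
          case 1
          then obtain L' a where L': "L = L' @ [a]" by (cases L rule: rev_cases) auto
          show ?thesis by (rule id_case[OF common(4)[OF L']]) (use 1 L' common(1) in auto)
        next
          case 2
          then obtain R' a where R': "R = a # R'" by (cases R) auto
          have "sublist R' (extend \<psi> ?X)" unfolding common(1) R'
            by (metis append.assoc append_Cons append_Nil sublist_append_leftI)
          then show ?thesis by (rule id_case[OF common(5)[OF R']]) (use 2 R' in auto)
        next
          case 3
          have "m\<psi> * 1 \<le> m\<psi> * (N2 + 2)" by (rule mult_le_mono2) simp
          then have m\<psi>M: "m\<psi> \<le> length M'" using 3 by simp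
          obtain X1 X2 X3 M1 M2 where t: "?X = X1 @ X2 @ X3" "M' = M1 @ extend \<psi> X2 @ M2"
            "extend \<psi> X1 = L @ M1" "extend \<psi> X3 = M2 @ R" "length M' \<le> m\<psi> * (length X2 + 2)"
            using extend_trim[OF common(1) _ m\<psi>M] m\<psi>(2) XB(1) by (metis in_listsD)
          have "m\<psi> * (N2 + 2) \<le> m\<psi> * (length X2 + 2)" by (rule le_trans[OF 3 t(5)])
          then have N2X: "N2 \<le> length X2" using m\<psi>(1) by simp
          have X2B: "X2 \<in> lists B" using XB(1) t(1) by auto
          \<comment> \<open>A common cut for \<psi> on the stretch where the words over B agree would be one for the composition.\<close>
          have "desync \<psi> X2 ?Y (Y1 @ M1) (M2 @ Y2)"
            unfolding desync_def
          proof (intro conjI allI impI notI)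
            show "extend \<psi> ?Y = (Y1 @ M1) @ extend \<psi> X2 @ M2 @ Y2" using common(2) t(2) by simp
            fix P Q assume PQ: "prefix P X2" "prefix Q ?Y" "(Y1 @ M1) @ extend \<psi> P = extend \<psi> Q"
            have "concat Y1 = p2 @ concat L" using common(3) by (simp add: extend_id)
            then have "p2 @ concat (extend \<psi> (X1 @ P)) = concat (extend \<psi> Q)"
              using t(3) by (simp flip: PQ(3))
            moreover have "prefix (X1 @ P) ?X" using PQ(1) t(1) by (auto simp: prefix_def)
            ultimately show False using no_cut PQ(2) by blast
          qed
          then obtain t' where t': "t' \<noteq> []" "length t' \<le> K2" "sublist (word_power t' q) X2"
            using N2[OF X2B XB(2) _ N2X] by blast
          have "set t' \<subseteq> set (word_power t' q)" using q by (cases q) auto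
          then have tB: "t' \<in> lists B" using set_mono_sublist[OF t'(3)] X2B by auto
          let ?z = "concat (extend \<psi> t')"
          have "length (extend (\<lambda>b. b) (extend \<psi> t')) \<le> mB * length (extend \<psi> t')"
            using mB \<psi>_extend[OF tB] by (intro length_extend_le) auto
          also have "length (extend \<psi> t') \<le> m\<psi> * length t'" using m\<psi> tB by (intro length_extend_le) auto
          also have "m\<psi> * length t' \<le> m\<psi> * K2" using t'(2) by simp
          finally have "length ?z \<le> K" by (simp add: extend_id K_def)
          moreover have "?z \<noteq> []"
            using t'(1) tB ne\<psi> \<psi> neid by (cases t') (auto, metis length_greater_0_conv length_iter less_le_trans)
          moreover have "sublist X2 ?X" using t(1) by auto
          then have "sublist (word_power ?z q) (concat (extend \<psi> ?X))"
            using sublist_extend[OF sublist_extend[OF sublist_order.order.trans[OF t'(3)], of _ \<psi>], of _ "\<lambda>b. b"]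
            by (simp add: extend_word_power extend_id concat_word_power)
          ultimately show ?thesis using in_x sublist_order.order.trans by blast
        qed
      qed
    qed
    then show ?thesis by blast
  qed
  then show thesis by (rule that)
qed

end

section \<open>From missing synchronization to repetitions\<close>

context substitution_language
begin

text \<open>
  There are finitely many words of length at most \<open>K\<close>, so one of them works for infinitely many exponents, and
  then for all, because lower powers are factors of higher ones.
\<close>

lemma pigeonhole_powers:
  assumes "\<And>q. 0 < q \<Longrightarrow> \<exists>z. z \<noteq> [] \<and> length z \<le> K \<and> word_power z q \<in> S \<and> P z"
  obtains z where "z \<noteq> []" "length z \<le> K" "\<And>q. word_power z q \<in> S" "P z"
proof -
  obtain Z where Z: "\<And>q. 0 < q \<Longrightarrow> Z q \<noteq> [] \<and> length (Z q) \<le> K \<and> word_power (Z q) q \<in> S \<and> P (Z q)"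
    using assms by metis
  have "Z ` {1..} \<subseteq> {w. w \<in> lists A \<and> length w \<le> K}"
  proof
    fix w assume "w \<in> Z ` {1..}"
    then obtain q where "w = Z q" "q \<in> {1..}" by (rule imageE)
    then have q: "0 < q" "w = Z q" by simp_all
    then have "set w \<subseteq> set (word_power (Z q) q)" by (cases q) auto
    moreover have "word_power (Z q) q \<in> lists A" using Z[OF q(1)] words by blast
    ultimately show "w \<in> {w. w \<in> lists A \<and> length w \<le> K}" using Z[OF q(1)] q(2) by auto
  qed
  then have "finite (Z ` {1..})" using finite_words_upto[OF finite_alphabet] finite_subset by blast
  then obtain q0 where q0: "q0 \<in> {1..}" "infinite {q \<in> {1..}. Z q = Z q0}"
    using pigeonhole_infinite[of "{1::nat..}" Z] infinite_Ici by blast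
  show thesis
  proof (rule that[of "Z q0"])
    show "Z q0 \<noteq> []" "length (Z q0) \<le> K" "P (Z q0)" using Z q0(1) by auto
    show "word_power (Z q0) q \<in> S" for q
    proof -
      have "\<not> (\<forall>n \<in> {q \<in> {1..}. Z q = Z q0}. n < Suc q)"
        using q0(2) finite_nat_set_iff_bounded by blast
      then obtain q' where "q' \<in> {1..}" "Z q' = Z q0" "\<not> q' < Suc q" by blast
      then have q': "q < q'" "q' \<in> {1..}" "Z q' = Z q0" by simp_all
      then have "prefix (word_power (Z q0) q) (word_power (Z q') q')"
        using prefix_word_power_mono[of q q' "Z q0"] by simp
      then have "sublist (word_power (Z q0) q) (word_power (Z q') q')" by (rule prefix_imp_sublist)
      moreover have "word_power (Z q') q' \<in> S" using Z[of q'] q'(1) by simp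
      ultimately show ?thesis by (rule factor_closed[rotated])
    qed
  qed
qed

text \<open>
  The exponent is increased so that the power is long enough to contain an unbounded letter, which then
  occurs in the base of the power.
\<close>

lemma long_desync_imp_repetitive:
  assumes "\<And>N. \<exists>x \<in> S. \<exists>y \<in> S. \<exists>p s. desync F x y p s \<and> N \<le> length x"
  obtains z a where "\<And>q. word_power z q \<in> S" "a \<in> set z" "\<not> bounded a"
proof -
  obtain K where K: "\<And>q. 0 < q \<Longrightarrow> \<exists>N. \<forall>x \<in> S. \<forall>y \<in> S. \<forall>p s. desync F x y p s \<longrightarrow> N \<le> length x \<longrightarrow>
    (\<exists>z. z \<noteq> [] \<and> length z \<le> K \<and> sublist (word_power z q) (extend F x))"
    using desync_imp_powers by blast
  obtain m where m: "0 < m" "\<And>a. a \<in> A \<Longrightarrow> length (F a) \<le> m"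
    using ex_length_bound[OF finite_alphabet, of F] by blast
  have "\<exists>z. z \<noteq> [] \<and> length z \<le> K \<and> word_power z q \<in> S \<and> (\<exists>a \<in> set z. \<not> bounded a)" if q: "0 < q" for q
  proof -
    let ?q = "q + m * (m + 2)"
    obtain x y p s z where z: "x \<in> S" "y \<in> S" "desync F x y p s" "z \<noteq> []" "length z \<le> K"
      "sublist (word_power z ?q) (extend F x)"
      using K[of ?q] assms q by (metis add_gr_0)
    have "?q * 1 \<le> ?q * length z" using z(4) by (intro mult_le_mono2) (cases z; simp)
    moreover have "m * (m + 2) \<le> ?q * 1" by simp
    ultimately have "m * (m + 2) \<le> length (word_power z ?q)"
      unfolding length_word_power by (rule le_trans[rotated])
    then obtain a where "a \<in> set (word_power z ?q)" "\<not> bounded a"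
      using desync_factor_unbounded[OF m _ _ z(3,6)] z(1,2) words by blast
    moreover have "prefix (word_power z q) (word_power z ?q)" by (rule prefix_word_power_mono) simp
    then have "word_power z q \<in> S"
      using factor_closed[OF image_closed[OF z(1)]] z(6) prefix_imp_sublist sublist_order.order.trans by blast
    ultimately show ?thesis using z(4,5) by auto
  qed
  then show thesis
  proof (rule pigeonhole_powers)
    fix z assume "\<And>q. word_power z q \<in> S" "\<exists>a \<in> set z. \<not> bounded a"
    then show thesis using that by blast
  qed
qed

text \<open>
  The outer words \<open>p\<close> and \<open>s\<close> are words over the alphabet because \<open>v\<close> and hence its image are.
\<close>

definition interprets :: "'a list \<Rightarrow> 'a list \<Rightarrow> 'a list \<Rightarrow> 'a list \<Rightarrow> bool" where
  "interprets u p v s \<longleftrightarrow> v \<noteq> [] \<and> v \<in> S \<and> extend F v = p @ u @ s"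

definition sync_delay :: "int \<Rightarrow> bool" where
  "sync_delay D \<longleftrightarrow>
     (\<forall>u p v s p' v' s'. u \<in> S \<and> u \<noteq> [] \<and> interprets u p v s \<and> interprets u p' v' s' \<longrightarrow>
        (\<forall>i < length v.
           int (length (extend F (take (Suc i) v))) - int (length p) > D \<and>
           int (length (extend F (drop (Suc i) v))) - int (length s) > D \<longrightarrow>
           (\<exists>j < length v'.
              int (length (extend F (take i v))) - int (length p) =
                int (length (extend F (take j v'))) - int (length p') \<and>
              v ! i = v' ! j)))"

text \<open>
  Let \<open>v\<close> and \<open>v'\<close> interpret \<open>u\<close>, and let the letter \<open>b\<close> of \<open>v\<close> be unmatched in \<open>v'\<close> though its image ends
  far from both ends of \<open>u\<close>. If there were common cuts in \<open>u\<close> both before and after the image of \<open>b\<close>, then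
  injectivity would make the two interpreting words equal in between, and \<open>b\<close> would be matched. So on one side of \<open>b\<close> all cuts
  inside \<open>u\<close> are private, and that side is long.
\<close>

lemma no_sync_delay_imp_desync:
  assumes nosync: "\<And>D. 0 < D \<Longrightarrow> \<not> sync_delay D"
  shows "\<exists>x \<in> S. \<exists>y \<in> S. \<exists>p s. desync F x y p s \<and> N \<le> length x"
proof -
  obtain m where m: "0 < m" "\<And>a. a \<in> A \<Longrightarrow> length (F a) \<le> m"
    using ex_length_bound[OF finite_alphabet, of F] by blast
  \<comment> \<open>Up to two letter images are lost on a side: the one that straddles the end of u, and that of b.\<close>
  define D where "D = m * (N + 2)"
  have "0 < D" using m(1) by (simp add: D_def)
  then have "0 < int D" by simp
  then obtain u p v s p' v' s' i where cex: "u \<in> S" "u \<noteq> []" "interprets u p v s" "interprets u p' v' s'"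
    "i < length v"
    "int (length (extend F (take (Suc i) v))) - int (length p) > int D"
    "int (length (extend F (drop (Suc i) v))) - int (length s) > int D"
    "\<not> (\<exists>j < length v'. int (length (extend F (take i v))) - int (length p) =
       int (length (extend F (take j v'))) - int (length p') \<and> v ! i = v' ! j)"
    using nosync[of "int D"] unfolding sync_delay_def by blast
  then have u: "u \<in> S" "u \<noteq> []" "v \<in> S" "extend F v = p @ u @ s" "v' \<in> S" "extend F v' = p' @ u @ s'"
    unfolding interprets_def by auto
  have i: "i < length v" "length p + D < length (extend F (take (Suc i) v))"
    "length s + D < length (extend F (drop (Suc i) v))" using cex(5-7) by linarith+
  have unmatched: "v ! i \<noteq> v' ! j" if "j < length v'"
    "length (extend F (take i v)) + length p' = length (extend F (take j v')) + length p" for j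
  proof -
    have "int (length (extend F (take i v))) - int (length p) =
       int (length (extend F (take j v'))) - int (length p')" using that(2) by linarith
    then show ?thesis using cex(8) that(1) by blast
  qed
  have vA: "v \<in> lists A" using u words by auto
  define V1 b V2 where "V1 = take i v" and "b = v ! i" and "V2 = drop (Suc i) v"
  have v: "v = V1 @ b # V2" using i(1) by (simp add: V1_def b_def V2_def id_take_nth_drop)
  have V1b: "take (Suc i) v = V1 @ [b]" using i(1) by (simp add: V1_def b_def take_Suc_conv_app_nth)
  have bA: "length (F b) \<le> m" using m(2) vA v by auto
  have long: "length p + D < length (extend F V1) + length (F b)" "length s + D < length (extend F V2)"
    using i(2,3) unfolding V1b by (simp_all add: V2_def)
  have mD: "2 * m \<le> D" using m(1) by (simp add: D_def algebra_simps)
  obtain A1 A2 C where A1: "v = A1 @ A2" "extend F A1 = p @ C" "length C \<le> m"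
    using extend_split_left[OF u(4), of m] m(2) vA by (metis in_listsD)
  obtain A3 A4 C' where A4: "v = A3 @ A4" "extend F A4 = C' @ s" "length C' \<le> m"
    using extend_split_right[of F v "p @ u" s m] u(4) m(2) vA by (metis append.assoc in_listsD)
  have "prefix A1 V1"
  proof (cases "prefix A1 V1")
    case False
    moreover have "prefix A1 v" "prefix V1 v" using A1(1) v by (metis prefixI)+
    ultimately have "prefix V1 A1" using prefix_same_cases by blast
    then have "length (extend F V1) \<le> length (extend F A1)" using prefix_extend prefix_length_le by blast
    then show ?thesis using long(1) A1(2,3) bA mD by simp
  qed
  then obtain x1 where x1: "V1 = A1 @ x1" by (auto simp: prefix_def)
  have "suffix A4 V2"
  proof (cases "suffix A4 V2")
    case False
    moreover have "suffix A4 v" "suffix V2 v"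
      using A4(1) v by (metis suffixI, metis append.assoc append_Cons append_Nil suffixI)
    ultimately have "suffix V2 A4" using suffix_same_cases by blast
    then have "length (extend F V2) \<le> length (extend F A4)" by (auto simp: suffix_def)
    then show ?thesis using long(2) A4(2,3) mD by simp
  qed
  then obtain x2 where x2: "V2 = x2 @ A4" by (auto simp: suffix_def)
  have vv: "v = A1 @ x1 @ b # x2 @ A4" using v x1 x2 by simp
  have "p @ (C @ extend F (x1 @ b # x2) @ C') @ s = p @ u @ s"
    unfolding u(4)[symmetric] vv using A1(2) A4(2) by simp
  then have ue: "u = C @ extend F (x1 @ b # x2) @ C'" by simp
  have "length (extend F x1) \<le> m * length x1" "length (extend F x2) \<le> m * length x2"
    using m(2) vA vv by (intro length_extend_le; auto)+
  moreover have "m * N < length (extend F x1)"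
    using long(1) x1 A1(2,3) bA by (simp add: D_def algebra_simps)
  moreover have "m * N < length (extend F x2)"
    using long(2) x2 A4(2,3) by (simp add: D_def algebra_simps)
  ultimately have "m * N < m * length x1" "m * N < m * length x2" by linarith+
  then have N: "N \<le> length x1" "N \<le> length x2" by simp_all
  have xS: "x1 \<in> S" "x2 \<in> S"
    using factor_closed[OF u(3)] vv by (auto simp: sublist_def) (metis append.assoc append_Cons append_Nil)+
  show ?thesis
  proof (cases "desync F x1 v' (p' @ C) (F b @ extend F x2 @ C' @ s')")
    case True
    then show ?thesis using xS(1) u(5) N(1) by blast
  next
    case no1: False
    show ?thesis
    proof (cases "desync F x2 v' (p' @ C @ extend F (x1 @ [b])) (C' @ s')")
      case True
      then show ?thesis using xS(2) u(5) N(2) by blast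
    next
      case no2: False
      obtain P1 Q1 where 1: "prefix P1 x1" "prefix Q1 v'" "(p' @ C) @ extend F P1 = extend F Q1"
        using no1 u(6) ue unfolding desync_def by auto
      obtain P2 Q2 where 2: "prefix P2 x2" "prefix Q2 v'" "(p' @ C @ extend F (x1 @ [b])) @ extend F P2 = extend F Q2"
        using no2 u(6) ue unfolding desync_def by auto
      obtain W where W: "x1 = P1 @ W" using 1(1) by (auto simp: prefix_def)
      have e2: "extend F Q2 = extend F Q1 @ extend F (W @ b # P2)" unfolding 2(3)[symmetric] 1(3)[symmetric] W by simp
      have "prefix Q1 Q2"
      proof (cases "prefix Q1 Q2")
        case False
        then have "prefix Q2 Q1" using 1(2) 2(2) prefix_same_cases by blast
        then have "Q2 = Q1" by (rule extend_prefix_eq[of _ _ F]) (use e2 nonerasing in auto)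
        then show ?thesis by simp
      qed
      then obtain Z where Z: "Q2 = Q1 @ Z" by (auto simp: prefix_def)
      obtain R where R: "v' = Q1 @ Z @ R" using 2(2) Z by (auto simp: prefix_def)
      have "Z \<in> S" using factor_closed[OF u(5)] R by auto
      moreover have "W @ b # P2 \<in> S"
      proof (rule factor_closed[OF u(3)])
        obtain P3 where "x2 = P2 @ P3" using 2(1) by (auto simp: prefix_def)
        then have "v = (A1 @ P1) @ (W @ b # P2) @ (P3 @ A4)" using vv W by simp
        then show "sublist (W @ b # P2) v" unfolding sublist_def by blast
      qed
      ultimately have "Z = W @ b # P2" using injective e2 Z by simp
      then have v': "v' = (Q1 @ W) @ b # P2 @ R" using R by simp
      let ?j = "length (Q1 @ W)"
      have "take ?j v' = Q1 @ W" "v' ! ?j = b" "?j < length v'"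
        unfolding v' by (simp_all only: append_eq_conv_conj nth_append_length) auto
      moreover have "length (extend F (take i v)) + length p' = length (extend F (Q1 @ W)) + length p"
      proof -
        have "extend F (Q1 @ W) = p' @ C @ extend F x1" using W by (simp flip: 1(3))
        moreover have "extend F (take i v) = p @ C @ extend F x1" using x1 A1(2) by (simp flip: V1_def)
        ultimately show ?thesis by simp
      qed
      ultimately show ?thesis using unmatched[of ?j] by (simp add: b_def)
    qed
  qed
qed

end

section \<open>Repetitions under a synchronization delay\<close>

text \<open>
  A factor of length \<open>|x|\<close> of a power of \<open>x\<close> is a conjugate of \<open>x\<close>.
\<close>

lemma rotation_in_power:
  assumes "word_power x k = L @ z @ R" "length z = length x"
  shows "\<exists>u v. x = u @ v \<and> z = v @ u"
  using assms(1)
proof (induction k arbitrary: L)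
  case 0
  then show ?case using assms(2) by auto
next
  case (Suc k)
  have eq: "x @ word_power x k = L @ z @ R" using Suc.prems by simp
  show ?case
  proof (cases "length x \<le> length L")
    case True
    then obtain L' where "L = x @ L'" using eq by (auto simp: append_eq_append_conv2)
    then show ?thesis using Suc.IH[of L'] eq by simp
  next
    case False
    then obtain v where v: "x = L @ v" using eq by (auto simp: append_eq_append_conv2)
    have zeq: "v @ word_power x k = z @ R" using eq v by simp
    then obtain z2 where z2: "z = v @ z2" "word_power x k = z2 @ R"
      using assms(2) v by (auto simp: append_eq_append_conv2)
    have len: "length z2 = length L" using assms(2) v z2 by simp
    have "z2 = L"
    proof (cases k)
      case 0
      then show ?thesis using z2(2) len by simp
    next
      case (Suc k')
      then have "L @ v @ word_power x k' = z2 @ R" using z2(2) v by simp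
      then show ?thesis using len by (metis append_eq_append_conv)
    qed
    then show ?thesis using v z2 by blast
  qed
qed

lemma length_extend_strict_mono:
  assumes "\<And>a. f a \<noteq> []" "i < j" "j \<le> length v"
  shows "length (extend f (take i v)) < length (extend f (take j v))"
proof (rule ccontr)
  assume "\<not> ?thesis"
  moreover have "prefix (take i v) (take j v)"
    using take_is_prefix[of i "take j v"] assms(2) by (simp add: min_def)
  ultimately have "take i v = take j v"
    using assms(1) by (intro extend_prefix_eq[of _ _ f]) auto
  then have "length (take i v) = length (take j v)" by simp
  then show False using assms by simp
qed

context substitution_language
begin

text \<open>
  A power \<open>x\<^sup>k\<close> occurs in some \<open>F(v)\<close>. The words \<open>(p, v, x s)\<close> and \<open>(p x, v, s)\<close> are two interpretations of
  \<open>x\<^bsup>k-1\<^esup>\<close> by the same \<open>v\<close>. By synchronization, each letter in the middle of \<open>v\<close> has a twin whose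
  image lies \<open>|x|\<close> further to the right. Neighbouring letters have neighbouring twins, so the distance in \<open>v\<close> is constant and \<open>v\<close> is
  periodic there. Its period \<open>y\<close> satisfies \<open>|F(y)| = |x|\<close>, and \<open>F(y)\<close> is a factor of a power of \<open>x\<close>.
\<close>

lemma repetition_descends:
  assumes D: "sync_delay D" "0 < D" and x: "x \<noteq> []" "\<And>q. word_power x q \<in> S"
  obtains y where "y \<noteq> []" "\<And>q. word_power y q \<in> S" "\<exists>u v. x = u @ v \<and> extend F y = v @ u"
proof -
  obtain m where m: "0 < m" "\<And>a. a \<in> A \<Longrightarrow> length (F a) \<le> m"
    using ex_length_bound[OF finite_alphabet, of F] by blast
  obtain N where N: "\<And>u. u \<in> S \<Longrightarrow> N < length u \<Longrightarrow> \<exists>v \<in> S. sublist u (extend F v)"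
    using ancestors by blast
  define d where "d = nat D"
  have D_eq: "D = int d" using D(2) by (simp add: d_def)
  have "\<exists>y. y \<noteq> [] \<and> length y \<le> length x \<and> word_power y q \<in> S \<and> (\<exists>u v. x = u @ v \<and> extend F y = v @ u)"
    if q: "0 < q" for q
  proof -
    define e where "e = q * length x"
    define k where "k = Suc (N + m * (2 * d + e + 2 * length x + 5))"
    let ?w = "word_power x k"
    have xlen: "1 \<le> length x" using x(1) by (cases x) auto
    have "k * 1 \<le> k * length x" using xlen by (rule mult_le_mono2)
    then have wlen: "k \<le> length ?w" by (simp add: length_word_power)
    then obtain v where v: "v \<in> S" "sublist ?w (extend F v)" using N[OF x(2)[of k]] by (auto simp: k_def)
    obtain p s where ps: "extend F v = p @ ?w @ s" using v(2) by (auto simp: sublist_def)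
    have vA: "v \<in> lists A" using v(1) words by auto
    have "m * 1 \<le> m * (2 * d + e + 2 * length x + 5)" by (rule mult_le_mono2) simp
    moreover have k_large: "m * (2 * d + e + 2 * length x + 5) < k" by (simp add: k_def)
    ultimately have mw: "m \<le> length ?w" using wlen by linarith
    obtain A1 V A4 C C' where t: "v = A1 @ V @ A4" "?w = C @ extend F V @ C'" "extend F A1 = p @ C"
      "extend F A4 = C' @ s" "length ?w \<le> m * (length V + 2)"
      using extend_trim[OF ps _ mw] m(2) vA by (metis in_listsD)
    have "m * (2 * d + e + 2 * length x + 5) < m * (length V + 2)"
      using k_large wlen t(5) by linarith
    then have "2 * d + e + 2 * length x + 5 < length V + 2" by (simp only: mult_less_cancel1)
    then have V: "2 * d + e + 2 * length x + 3 < length V" by linarith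
    \<comment> \<open>The position of the i-th cut.\<close>
    define T where "T i = length (extend F (take i v))" for i
    have T_mono: "T i < T j" if "i < j" "j \<le> length v" for i j
      unfolding T_def by (rule length_extend_strict_mono[OF nonerasing that])
    have T_inj: "i = j" if "T i = T j" "i \<le> length v" "j \<le> length v" for i j
      using T_mono[of i j] T_mono[of j i] that by (cases i j rule: linorder_cases) auto
    have T_Suc: "T (Suc i) = T i + length (F (v ! i))" if "i < length v" for i
      using that by (simp add: T_def take_Suc_conv_app_nth)
    define k' where "k' = k - 1"
    have w_eq: "?w = x @ word_power x k'" "?w = word_power x k' @ x"
      using word_power_add[of 1 k' x] word_power_add[of k' 1 x] by (simp_all add: k'_def k_def)
    have vne: "v \<noteq> []" using V t(1) by auto
    have "word_power x k' \<noteq> []"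
    proof -
      have "0 < k'" using m(1) by (simp add: k'_def k_def)
      then show ?thesis using x(1) by (cases k') auto
    qed
    moreover have "interprets (word_power x k') p v (x @ s)"
      unfolding interprets_def using ps w_eq(2) v(1) vne by simp
    moreover have "interprets (word_power x k') (p @ x) v s"
      unfolding interprets_def using ps w_eq(1) v(1) vne by simp
    ultimately have sync: "\<exists>j < length v. int (T i) - int (length p) = int (T j) - int (length (p @ x)) \<and> v ! i = v ! j"
      if "i < length v" "int (T (Suc i)) - int (length p) > D"
        "int (length (extend F (drop (Suc i) v))) - int (length (x @ s)) > D" for i
      using D(1) x(2)[of k'] that unfolding sync_delay_def T_def by blast
    \<comment> \<open>A letter at an index between a and b is followed and preceded by enough letters of V for the delay to
      apply: every letter contributes at least one to the length of the image.\<close>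
    define a where "a = length A1 + d"
    define b where "b = length A1 + length V - (d + length x + 2)"
    have ab: "a + e + length x < b" using V by (simp add: a_def b_def)
    have bv: "b + d + length x + 2 = length A1 + length V" using V by (simp add: b_def)
    have v_len: "length A1 + length V \<le> length v" using t(1) by simp
    have shift: "\<exists>j < length v. T j = T i + length x \<and> v ! j = v ! i" if i: "a \<le> i" "i \<le> b" for i
    proof -
      have iv: "Suc i < length v" using i bv v_len by linarith
      have "length p + d < T (Suc i)"
      proof -
        have "take (Suc i) v = A1 @ take (Suc i - length A1) (V @ A4)" using i t(1) by (simp add: a_def)
        then have "T (Suc i) = length (extend F A1) + length (extend F (take (Suc i - length A1) (V @ A4)))"
          by (simp add: T_def)
        moreover have "Suc i - length A1 \<le> length (extend F (take (Suc i - length A1) (V @ A4)))"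
          using length_image[of "take (Suc i - length A1) (V @ A4)"] iv t(1) by simp
        moreover have "d < Suc i - length A1" using i by (simp add: a_def)
        ultimately show ?thesis using t(3) by simp
      qed
      moreover have "length (x @ s) + d < length (extend F (drop (Suc i) v))"
      proof -
        have iV: "length A1 \<le> Suc i" "Suc i - length A1 \<le> length V" using i bv by (simp_all add: a_def)
        then have "drop (Suc i) v = drop (Suc i - length A1) V @ A4" using t(1) by simp
        moreover have "length V - (Suc i - length A1) \<le> length (extend F (drop (Suc i - length A1) V))"
          using length_image[of "drop (Suc i - length A1) V"] by simp
        moreover have "d + length x < length V - (Suc i - length A1)" using i bv iV by linarith
        ultimately show ?thesis using t(4) by simp
      qed
      ultimately obtain j where "j < length v" "int (T i) - int (length p) = int (T j) - int (length (p @ x))"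
        "v ! i = v ! j" using sync[of i] iv D_eq by auto
      then show ?thesis by (intro exI[of _ j]) auto
    qed
    obtain c where c: "c < length v" "T c = T a + length x" using shift[of a] ab by auto
    have "a < c"
    proof (rule ccontr)
      assume "\<not> a < c"
      then have "c = a \<or> c < a" by auto
      then have "T c \<le> T a" using T_mono[of c a] ab bv v_len by auto
      then show False using c(2) xlen by simp
    qed
    \<comment> \<open>The period of v, as a number of letters.\<close>
    define \<pi> where "\<pi> = c - a"
    have \<pi>: "0 < \<pi>" "c = a + \<pi>" using \<open>a < c\<close> by (simp_all add: \<pi>_def)
    have periodic: "a + \<pi> + i < length v \<and> T (a + \<pi> + i) = T (a + i) + length x \<and> v ! (a + \<pi> + i) = v ! (a + i)"
      if "a + i \<le> b" for i
      using that
    proof (induction i)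
      case 0
      obtain j where "j < length v" "T j = T a + length x" "v ! j = v ! a" using shift[of a] ab by auto
      moreover have "j = c" using calculation c T_inj[of j c] by simp
      ultimately show ?case using \<pi> by simp
    next
      case (Suc i)
      have IH: "a + \<pi> + i < length v" "T (a + \<pi> + i) = T (a + i) + length x" "v ! (a + \<pi> + i) = v ! (a + i)"
        using Suc by auto
      obtain j where j: "j < length v" "T j = T (a + Suc i) + length x" "v ! j = v ! (a + Suc i)"
        using shift[of "a + Suc i"] Suc.prems by auto
      have "a + i < length v" using Suc.prems bv v_len by linarith
      then have "T j = T (Suc (a + \<pi> + i))" using j(2) IH T_Suc[of "a + i"] T_Suc[of "a + \<pi> + i"] by simp
      then have "j = Suc (a + \<pi> + i)" using j(1) IH(1) T_inj[of j "Suc (a + \<pi> + i)"] by simp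
      then show ?case using j by simp
    qed
    define W where "W = drop a (take (Suc (b + \<pi>)) v)"
    define y where "y = take \<pi> (drop a v)"
    have b_end: "b + \<pi> < length v" using periodic[of "b - a"] ab by simp
    have Wlen: "length W = Suc (b + \<pi>) - a" using b_end by (simp add: W_def)
    have ylen: "length y = \<pi>" using b_end ab by (simp add: y_def)
    have W_nth: "W ! i = v ! (a + i)" if "i < length W" for i
      using that b_end ab by (simp add: W_def)
    have Wy: "W = y @ drop \<pi> W"
    proof -
      have "take \<pi> W = y" unfolding W_def y_def using ab by (simp add: drop_take min_def)
      then show ?thesis by (metis append_take_drop_id)
    qed
    have Wdrop: "drop \<pi> W = take (length (drop \<pi> W)) W"
    proof (rule nth_equalityI)
      fix i assume i: "i < length (drop \<pi> W)"
      then have "i < length W" "\<pi> + i < length W" "a + i \<le> b" using Wlen by auto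
      then show "drop \<pi> W ! i = take (length (drop \<pi> W)) W ! i"
        using i periodic[of i] W_nth[of i] W_nth[of "\<pi> + i"] by (simp add: add.assoc)
    qed simp
    have "prefix (drop \<pi> W) W" by (subst Wdrop) (rule take_is_prefix)
    have image_len: "length (extend F y) = length x"
    proof -
      have "take c v = take a v @ y" unfolding \<pi>(2) y_def by (simp add: take_add)
      then have "T c = T a + length (extend F y)" by (simp add: T_def)
      then show ?thesis using c(2) by simp
    qed
    then have yx: "length y \<le> length x" using length_image[of y] by simp
    have "q * length y \<le> length W"
    proof -
      have "q * length y \<le> e" unfolding e_def using yx by (rule mult_le_mono2)
      then show ?thesis using Wlen ab by linarith
    qed
    then have "prefix (word_power y q) W" using prefix_word_power[OF Wy \<open>prefix (drop \<pi> W) W\<close>] by blast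
    then have "sublist (word_power y q) W" by (rule prefix_imp_sublist)
    moreover have "sublist W v" unfolding W_def by (metis sublist_drop sublist_order.order.trans sublist_take)
    ultimately have "word_power y q \<in> S" using factor_closed[OF v(1)] sublist_order.order.trans by blast
    moreover have "y \<noteq> []" using ylen \<pi> by auto
    moreover have "\<exists>u v. x = u @ v \<and> extend F y = v @ u"
    proof -
      \<comment> \<open>The period starting at a ends within V, so its image lies inside the power of x.\<close>
      have "T c \<le> T (length A1 + length V)"
      proof -
        have "drop a v = drop a (A1 @ V) @ A4" using t(1) ab bv by simp
        then have "take (length A1 + length V) v = take a v @ drop a (A1 @ V)"
          using t(1) ab bv by (metis append.assoc append_eq_conv_conj append_same_eq append_take_drop_id length_append)
        then have "T (length A1 + length V) = T a + length (extend F (drop a (A1 @ V)))" by (simp add: T_def)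
        moreover have "length (drop a (A1 @ V)) \<le> length (extend F (drop a (A1 @ V)))" by (rule length_image)
        moreover have "length x \<le> length (drop a (A1 @ V))" using ab bv by simp
        ultimately show ?thesis using c(2) by simp
      qed
      then have cV: "c \<le> length A1 + length V"
        using T_mono[of "length A1 + length V" c] c(1) by (cases "c \<le> length A1 + length V") auto
      have "y = take \<pi> (drop a (A1 @ V))" unfolding y_def using t(1) cV \<pi>(2) by simp
      also have "drop a (A1 @ V) = drop d V" by (simp add: a_def)
      finally have "sublist y V" by (metis sublist_drop sublist_order.order.trans sublist_take)
      then have "sublist (extend F y) (extend F V)" by (rule sublist_extend)
      then have "sublist (extend F y) ?w" unfolding t(2) using sublist_order.order.trans by blast
      then obtain L R where "?w = L @ extend F y @ R" by (auto simp: sublist_def)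
      then show ?thesis using image_len by (rule rotation_in_power)
    qed
    ultimately show ?thesis using yx by blast
  qed
  then show thesis
    by (rule pigeonhole_powers) (assumption | rule that)+
qed

text \<open>
  Descending repeatedly gives words \<open>Y i\<close> with \<open>|F\<^bsup>n+i\<^esup>(Y i)| = |F\<^sup>n(x)|\<close> for all \<open>n\<close>; conjugate words have
  iterates of equal length. All \<open>Y i\<close> have length at most \<open>|x|\<close>, so two of them coincide, and the lengths of the iterates of
  \<open>x\<close> are periodic. They are also monotone, hence constant.
\<close>

lemma sync_delay_imp_bounded_repetitions:
  assumes D: "sync_delay D" "0 < D" and x: "\<And>q. word_power x q \<in> S" and a: "a \<in> set x"
  shows "bounded a"
proof -
  define rep where "rep y \<longleftrightarrow> y \<noteq> [] \<and> (\<forall>q. word_power y q \<in> S)" for y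
  have step: "\<exists>z. rep z \<and> (\<forall>n. length ((extend F ^^ n) y) = length ((extend F ^^ Suc n) z))" if "rep y" for y
  proof -
    obtain z u v where z: "z \<noteq> []" "\<And>q. word_power z q \<in> S" "y = u @ v" "extend F z = v @ u"
      using repetition_descends[OF D, of y] \<open>rep y\<close> unfolding rep_def by metis
    have "length ((extend F ^^ n) y) = length ((extend F ^^ Suc n) z)" for n
      unfolding funpow_Suc_right comp_apply z(3,4) by (simp add: iter_append)
    then show ?thesis using z(1,2) by (auto simp: rep_def)
  qed
  have "rep x" using x a by (auto simp: rep_def)
  then obtain Y where Y0: "Y 0 = x" and rep: "\<And>i. rep (Y i)"
    and Y: "\<And>i n. length ((extend F ^^ n) (Y i)) = length ((extend F ^^ Suc n) (Y (Suc i)))"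
  proof -
    let ?P = "\<lambda>(i::nat) y. rep y \<and> (i = 0 \<longrightarrow> y = x)"
    let ?Q = "\<lambda>(i::nat) y z. \<forall>n. length ((extend F ^^ n) y) = length ((extend F ^^ Suc n) z)"
    have "\<exists>Y. \<forall>i. ?P i (Y i) \<and> ?Q i (Y i) (Y (Suc i))"
    proof (rule dependent_nat_choice)
      show "\<exists>y. ?P 0 y" using \<open>rep x\<close> by blast
      show "\<exists>z. ?P (Suc i) z \<and> ?Q i y z" if "?P i y" for y i
        using step[of y] that by blast
    qed
    then obtain Y where "\<And>i. ?P i (Y i)" "\<And>i. ?Q i (Y i) (Y (Suc i))" by blast
    then show ?thesis using that[of Y] by blast
  qed
  have len: "length ((extend F ^^ (n + i)) (Y i)) = length ((extend F ^^ n) x)" for n i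
  proof (induction i)
    case (Suc i)
    then show ?case using Y[of "n + i" i] by simp
  qed (simp add: Y0)
  have "Y i \<in> {w. w \<in> lists A \<and> length w \<le> length x}" for i
  proof -
    have "word_power (Y i) 1 \<in> S" using rep[of i] unfolding rep_def by blast
    then have "Y i \<in> lists A" using words by auto
    moreover have "length (Y i) \<le> length x" using length_iter[of "Y i" i] len[of 0 i] by simp
    ultimately show ?thesis by simp
  qed
  then have "range Y \<subseteq> {w. w \<in> lists A \<and> length w \<le> length x}" by (rule image_subsetI)
  then have "finite (range Y)" by (rule finite_subset[OF _ finite_words_upto[OF finite_alphabet]])
  then obtain i j where "i \<noteq> j" "Y i = Y j" using finite_imageD[of Y UNIV] by (auto simp: inj_on_def)
  then obtain i j where ij: "i < j" "Y i = Y j" by (metis linorder_neqE_nat)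
  define l where "l n = length ((extend F ^^ (n + i)) (Y i))" for n
  have l_x: "l n = length ((extend F ^^ n) x)" for n unfolding l_def by (rule len)
  have period: "l (n + (j - i)) = l n" for n
  proof -
    have "l (n + (j - i)) = length ((extend F ^^ (n + j)) (Y j))" using ij by (simp add: l_def)
    then show ?thesis using len[of n j] l_x by simp
  qed
  have l_mono: "l n \<le> l n'" if "n \<le> n'" for n n' unfolding l_x using that by (rule length_iter_mono)
  have "l (n * (j - i)) = l 0" for n
    by (induction n) (use period[of "_ * (j - i)"] in \<open>simp_all add: add.commute\<close>)
  moreover have "n * 1 \<le> n * (j - i)" for n by (rule mult_le_mono2) (use ij(1) in simp)
  ultimately have "l n \<le> l 0" for n using l_mono[of n "n * (j - i)"] by simp
  then have "length ((extend F ^^ n) x) \<le> length x" for n unfolding l_x by simp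
  moreover have "length (iter n a) \<le> length ((extend F ^^ n) x)" for n
  proof -
    have "sublist (extend (iter n) [a]) (extend (iter n) x)" using a by (intro sublist_extend) (auto simp: in_set_conv_decomp sublist_def)
    then show ?thesis by (simp add: iter_extend sublist_length_le)
  qed
  ultimately show ?thesis unfolding bounded_def using le_trans by blast
qed

lemma not_circular_iff_unboundedly_repetitive:
  "(\<not> (\<exists>D > 0. sync_delay D)) \<longleftrightarrow> (\<exists>x. (\<forall>q. word_power x q \<in> S) \<and> (\<exists>a \<in> set x. \<not> bounded a))"
  (is "?L \<longleftrightarrow> ?R")
proof
  assume ?L
  then have "\<And>N. \<exists>x \<in> S. \<exists>y \<in> S. \<exists>p s. desync F x y p s \<and> N \<le> length x"
    by (intro no_sync_delay_imp_desync) blast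
  then show ?R
  proof (rule long_desync_imp_repetitive)
    fix z a assume "\<And>q. word_power z q \<in> S" "a \<in> set z" "\<not> bounded a"
    then show ?R by blast
  qed
next
  assume ?R
  then show ?L using sync_delay_imp_bounded_repetitions by metis
qed

end

section \<open>The characterization for D0L systems\<close>

theorem theorem12:
  fixes G :: "'a D0L"
  assumes "D0L_system G"
    and "injective_D0L G"
  shows "\<not> circular_D0L G \<longleftrightarrow> unboundedly_repetitive G"
proof -
  let ?A = "alphabet G" and ?\<phi> = "morph G" and ?S = "D0L_factors G"
  \<comment> \<open>Letters outside of the alphabet are fixed, which makes the morphism nonerasing everywhere.\<close>
  define F where "F a = (if a \<in> ?A then ?\<phi> [a] else [a])" for a
  have finA: "finite ?A" and start: "start G \<in> lists ?A" and lettersS: "\<And>a. a \<in> ?A \<Longrightarrow> [a] \<in> ?S"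
    and closed: "\<And>x. x \<in> lists ?A \<Longrightarrow> ?\<phi> x \<in> lists ?A" and Nil: "?\<phi> [] = []"
    and hom: "\<And>x y. x \<in> lists ?A \<Longrightarrow> y \<in> lists ?A \<Longrightarrow> ?\<phi> (x @ y) = ?\<phi> x @ ?\<phi> y"
    using assms(1) unfolding D0L_system_def endomorphism_on_def by blast+
  have inj: "\<And>x y. x \<in> ?S \<Longrightarrow> y \<in> ?S \<Longrightarrow> ?\<phi> x = ?\<phi> y \<Longrightarrow> x = y"
    using assms(2) unfolding injective_D0L_def by blast
  have \<phi>: "?\<phi> w = extend F w" if "w \<in> lists ?A" for w
    using that
  proof (induction w)
    case (Cons a w)
    then show ?case using hom[of "[a]" w] by (simp add: F_def)
  qed (simp add: Nil)
  have pow_closed: "(?\<phi> ^^ n) w \<in> lists ?A" if "w \<in> lists ?A" for n w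
    by (induction n) (use that closed in simp_all)
  have pow: "(?\<phi> ^^ n) w = (extend F ^^ n) w" if "w \<in> lists ?A" for n w
  proof (induction n)
    case (Suc n)
    then show ?case using \<phi>[OF pow_closed[OF that, of n]] by simp
  qed simp
  have S_words: "?S \<subseteq> lists ?A"
  proof
    fix u assume "u \<in> ?S"
    then obtain n where "sublist u ((?\<phi> ^^ n) (start G))" by (auto simp: D0L_factors_def D0L_language_def)
    then show "u \<in> lists ?A" using pow_closed[OF start, of n] set_mono_sublist by fastforce
  qed
  have factorsI: "u \<in> ?S" if "sublist u ((extend F ^^ n) (start G))" for u n
    using that unfolding pow[OF start, symmetric] D0L_factors_def D0L_language_def by blast
  have factorsE: "\<exists>n. sublist u ((extend F ^^ n) (start G))" if "u \<in> ?S" for u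
    using that unfolding pow[OF start, symmetric] D0L_factors_def D0L_language_def by blast
  interpret substitution_language ?A F ?S
  proof
    show "finite ?A" by (rule finA)
    have "[] \<in> ?S" by (rule factorsI[of _ 0]) simp
    then show "F a \<noteq> []" for a using inj[of "[a]" "[]"] lettersS[of a] Nil by (auto simp: F_def)
    show "F a \<in> lists ?A" if "a \<in> ?A" for a using closed[of "[a]"] that by (simp add: F_def)
    show "?S \<subseteq> lists ?A" by (rule S_words)
    show "u \<in> ?S" if "v \<in> ?S" "sublist u v" for u v
      using factorsE[OF that(1)] factorsI that(2) sublist_order.order.trans by blast
    show "extend F u \<in> ?S" if u: "u \<in> ?S" for u
    proof -
      obtain n where "sublist u ((extend F ^^ n) (start G))" using factorsE[OF u] by blast
      then show ?thesis using factorsI[of "extend F u" "Suc n"] sublist_extend by auto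
    qed
    show "[a] \<in> ?S" if "a \<in> ?A" for a using that by (rule lettersS)
    show "u = v" if "u \<in> ?S" "v \<in> ?S" "extend F u = extend F v" for u v
      using inj[OF that(1,2)] \<phi>[OF subsetD[OF S_words that(1)]] \<phi>[OF subsetD[OF S_words that(2)]] that(3)
      by simp
    show "\<exists>N. \<forall>u \<in> ?S. N < length u \<longrightarrow> (\<exists>v \<in> ?S. sublist u (extend F v))"
    proof (intro exI[of _ "length (start G)"] ballI impI)
      fix u assume u: "u \<in> ?S" "length (start G) < length u"
      obtain n where n: "sublist u ((extend F ^^ n) (start G))" using factorsE[OF u(1)] by blast
      then obtain n' where "n = Suc n'" using u(2) by (cases n) (auto dest: sublist_length_le)
      then show "\<exists>v \<in> ?S. sublist u (extend F v)"
        using n factorsI[of _ n'] by (intro bexI[of _ "(extend F ^^ n') (start G)"]) auto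
    qed
  qed
  have bounded: "bounded_letter G a \<longleftrightarrow> bounded a" if a: "a \<in> ?A" for a
  proof -
    have orbit: "{(?\<phi> ^^ n) [a] |n. True} = range (\<lambda>n. iter n a)"
      using pow[of "[a]"] a by (auto simp: iter_def)
    show ?thesis
    proof
      assume "bounded_letter G a"
      then have "finite (length ` range (\<lambda>n. iter n a))" unfolding bounded_letter_def orbit by simp
      then obtain L where "\<forall>l \<in> length ` range (\<lambda>n. iter n a). l \<le> L"
        using finite_nat_set_iff_bounded_le by blast
      then show "bounded a" by (auto simp: bounded_def)
    next
      assume "bounded a"
      then obtain L where "\<And>n. length (iter n a) \<le> L" by (auto simp: bounded_def)
      then have "range (\<lambda>n. iter n a) \<subseteq> {w. w \<in> lists ?A \<and> length w \<le> L}"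
        using iter_in_lists[of "[a]"] a by (auto simp: iter_def)
      then show "bounded_letter G a" unfolding bounded_letter_def orbit
        using finite_words_upto[OF finA] finite_subset by blast
    qed
  qed
  have rep: "unboundedly_repetitive G \<longleftrightarrow> (\<exists>x. (\<forall>q. word_power x q \<in> ?S) \<and> (\<exists>a \<in> set x. \<not> bounded a))"
  proof
    assume "unboundedly_repetitive G"
    then obtain x a where x: "x \<in> ?S" "a \<in> set x" "\<not> bounded_letter G a" "\<forall>q. word_power x q \<in> ?S"
      unfolding unboundedly_repetitive_def by blast
    moreover have "a \<in> ?A" using x S_words by auto
    ultimately show "\<exists>x. (\<forall>q. word_power x q \<in> ?S) \<and> (\<exists>a \<in> set x. \<not> bounded a)"
      using bounded by blast
  next
    assume "\<exists>x. (\<forall>q. word_power x q \<in> ?S) \<and> (\<exists>a \<in> set x. \<not> bounded a)"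
    then obtain x a where x: "\<forall>q. word_power x q \<in> ?S" "a \<in> set x" "\<not> bounded a" by blast
    have "word_power x 1 \<in> ?S" using x(1) by blast
    then have "x \<in> ?S" by simp
    moreover have "a \<in> ?A" using calculation x(2) S_words by auto
    ultimately show "unboundedly_repetitive G"
      unfolding unboundedly_repetitive_def using x bounded by blast
  qed
  have SA: "v \<in> lists ?A" if "v \<in> ?S" for v using S_words that by (rule subsetD)
  have interp: "interpretation_of G u p v s \<longleftrightarrow> interprets u p v s" for u p v s
  proof
    assume "interpretation_of G u p v s"
    then show "interprets u p v s"
      unfolding interpretation_of_def interprets_def using \<phi>[OF SA, of v] by simp
  next
    assume i: "interprets u p v s"
    then have v: "v \<in> ?S" by (simp add: interprets_def)
    then have "extend F v \<in> lists ?A" by (intro image_in_lists SA)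
    then show "interpretation_of G u p v s"
      using i \<phi>[OF SA[OF v]] unfolding interpretation_of_def interprets_def by simp
  qed
  have "synchronization_delay G D \<longleftrightarrow> sync_delay D" for D
  proof -
    have factor: "?\<phi> (take i v) = extend F (take i v)" "?\<phi> (drop i v) = extend F (drop i v)"
      if "v \<in> ?S" for i v
      using SA[OF that] by (auto intro!: \<phi> dest: in_set_takeD in_set_dropD)
    show ?thesis
      unfolding synchronization_delay_def sync_delay_def interp
      by (intro arg_cong[where f = All] HOL.ext imp_cong refl) (auto simp: interprets_def factor)
  qed
  then show ?thesis
    using not_circular_iff_unboundedly_repetitive unfolding circular_D0L_def rep by simp
qed

end
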